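(* Let $\{X_t\}$ be an irreducible, positive recurrent Markov chain, in discrete time (and then also assumed aperiodic) or in continuous time, with finite or countably infinite state space $\mathcal{S}$ and stationary distribution $\boldsymbol\pi=(\pi_j)_{j\in\mathcal{S}}$. Let $K'=\sum_{j\in\mathcal{S}}\pi_j\,\mathrm{E}_i[\theta_j]\in[0,\infty]$ (a value that does not depend on $i\in\mathcal{S}$), and let $\mathcal{D}$ be the deviation matrix of the chain. 1. If $\mathcal{S}$ is finite, then $K'=\sum_{j\in\mathcal{S}}\mathcal{D}_{jj}$. 2. If $\mathcal{S}$ is infinite and $\mathcal{D}$ exists, then $K'$ is finite and equal to $\sum_{j\in\mathcal{S}}\mathcal{D}_{jj}$ if this sum is finite, and $K'$ is infinite if $\sum_{j\in\mathcal{S}}\mathcal{D}_{jj}$ is infinite. 3. If $\mathcal{S}$ is infinite and $\mathcal{D}$ does not exist, then $K'=\infty$.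
   Context: $\theta_j=\inf\{t\ge0:X_t=j\}$ is the first hitting time of $j$, and $\mathrm{E}_i[\cdot]$ is conditional expectation given $X_0=i$. The deviation matrix is defined, in discrete time with transition matrix $P$, by $$\mathcal{D}=\sum_{n\ge0}\big(P^n-\boldsymbol 1\boldsymbol\pi^{\mathsf T}\big),\qquad\text{i.e. } \mathcal{D}_{ij}=\sum_{n\ge0}\big([P^n]_{ij}-\pi_j\big),$$ and, in continuous time with generator $Q$, by $$\mathcal{D}=\int_0^\infty\big(e^{Qt}-\boldsymbol 1\boldsymbol\pi^{\mathsf T}\big)\,\mathrm{d}t,\qquad\text{i.e. } \mathcal{D}_{ij}=\int_0^\infty\big(\mathrm{P}_i[X_t=j]-\pi_j\big)\,\mathrm{d}t,$$ where $\boldsymbol 1$ is the column vector of ones and $\mathrm{P}_i$ is conditional probability given $X_0=i$. $\mathcal{D}$ is said to exist if the series (respectively the integral) converges entrywise. It is known that $\mathcal{D}$ exists if and only if $\mathrm{E}_\pi[\theta_j]<\infty$ for some $j\in\mathcal{S}$ (and then for every $j$), where $\mathrm{E}_\pi$ is conditional expectation given that $X_0$ has distribution $\boldsymbol\pi$; when $\mathcal{S}$ is finite it always exists. *)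

theory Defs
  imports "HOL-Probability.Probability"
begin

text \<open>
  The state space is a type of class \<open>countable\<close>, hence nonempty and finite or countably
  infinite.  A chain is given by a family of probability measures \<open>M i\<close>, one for each state
  \<open>i\<close>, playing the role of the conditional law given \<open>X 0 = i\<close>, and a process \<open>X\<close> on the
  underlying sample space.  Expected times are Lebesgue integrals with values in \<open>[0, \<infinity>]\<close>.
\<close>

section \<open>Notions common to discrete and continuous time\<close>

definition prob_dist :: "('s \<Rightarrow> real) \<Rightarrow> bool" where
  "prob_dist \<pi> \<longleftrightarrow> (\<forall>i. 0 \<le> \<pi> i) \<and> (\<pi> has_sum 1) UNIV"

definition stochastic_matrix :: "('s \<Rightarrow> 's \<Rightarrow> real) \<Rightarrow> bool" where
  "stochastic_matrix P \<longleftrightarrow> (\<forall>i. prob_dist (P i))"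

text \<open>The sum \<open>\<Sum>j. \<pi> j * E i j\<close> defining \<open>K'\<close>, where \<open>E i j\<close> is the expected hitting
  time of \<open>j\<close> from \<open>i\<close>.\<close>

definition kemeny_sum :: "('s \<Rightarrow> real) \<Rightarrow> ('s \<Rightarrow> 's \<Rightarrow> ennreal) \<Rightarrow> 's \<Rightarrow> ennreal" where
  "kemeny_sum \<pi> E i = (\<Sum>\<^sub>\<infinity>j. ennreal (\<pi> j) * E i j)"


section \<open>Discrete time\<close>

fun mat_pow :: "('s \<Rightarrow> 's \<Rightarrow> real) \<Rightarrow> nat \<Rightarrow> 's \<Rightarrow> 's \<Rightarrow> real" where
  "mat_pow P 0 i j = (if i = j then 1 else 0)"
| "mat_pow P (Suc n) i j = (\<Sum>\<^sub>\<infinity>k. P i k * mat_pow P n k j)"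

definition dt_markov_chain ::
    "('s::countable \<Rightarrow> 's \<Rightarrow> real) \<Rightarrow> ('s \<Rightarrow> 'w measure) \<Rightarrow> (nat \<Rightarrow> 'w \<Rightarrow> 's) \<Rightarrow> bool" where
  "dt_markov_chain P M X \<longleftrightarrow>
     stochastic_matrix P \<and>
     (\<forall>i. prob_space (M i)) \<and>
     (\<forall>i n. X n \<in> M i \<rightarrow>\<^sub>M count_space UNIV) \<and>
     (\<forall>i. AE \<omega> in M i. X 0 \<omega> = i) \<and>
     (\<forall>i n x j. \<P>(\<omega> in M i. \<forall>k\<le>n. X k \<omega> = x k) > 0 \<longrightarrow>
        \<P>(\<omega> in M i. X (Suc n) \<omega> = j \<bar> \<forall>k\<le>n. X k \<omega> = x k) = P (x n) j)"

definition dt_irreducible :: "('s \<Rightarrow> 's \<Rightarrow> real) \<Rightarrow> bool" where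
  "dt_irreducible P \<longleftrightarrow> (\<forall>i j. \<exists>n. mat_pow P n i j > 0)"

definition dt_aperiodic :: "('s \<Rightarrow> 's \<Rightarrow> real) \<Rightarrow> bool" where
  "dt_aperiodic P \<longleftrightarrow> (\<forall>i. Gcd {n::nat. n > 0 \<and> mat_pow P n i i > 0} = 1)"

text \<open>The infimum of the empty set in \<^typ>\<open>ennreal\<close> is \<open>\<infinity>\<close>.\<close>

definition dt_hitting_time :: "(nat \<Rightarrow> 'w \<Rightarrow> 's) \<Rightarrow> 's \<Rightarrow> 'w \<Rightarrow> ennreal" where
  "dt_hitting_time X j \<omega> = (INF n\<in>{n. X n \<omega> = j}. of_nat n)"

definition dt_return_time :: "(nat \<Rightarrow> 'w \<Rightarrow> 's) \<Rightarrow> 's \<Rightarrow> 'w \<Rightarrow> ennreal" where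
  "dt_return_time X j \<omega> = (INF n\<in>{n. n \<ge> 1 \<and> X n \<omega> = j}. of_nat n)"

definition dt_mean_hitting ::
    "('s \<Rightarrow> 'w measure) \<Rightarrow> (nat \<Rightarrow> 'w \<Rightarrow> 's) \<Rightarrow> 's \<Rightarrow> 's \<Rightarrow> ennreal" where
  "dt_mean_hitting M X i j = (\<integral>\<^sup>+\<omega>. dt_hitting_time X j \<omega> \<partial>M i)"

definition dt_positive_recurrent :: "('s \<Rightarrow> 'w measure) \<Rightarrow> (nat \<Rightarrow> 'w \<Rightarrow> 's) \<Rightarrow> bool" where
  "dt_positive_recurrent M X \<longleftrightarrow> (\<forall>i. (\<integral>\<^sup>+\<omega>. dt_return_time X i \<omega> \<partial>M i) < \<infinity>)"

definition dt_stationary :: "('s \<Rightarrow> 's \<Rightarrow> real) \<Rightarrow> ('s \<Rightarrow> real) \<Rightarrow> bool" where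
  "dt_stationary P \<pi> \<longleftrightarrow>
     prob_dist \<pi> \<and> (\<forall>j. ((\<lambda>i. \<pi> i * P i j) has_sum \<pi> j) UNIV)"

definition dt_deviation_exists :: "('s \<Rightarrow> 's \<Rightarrow> real) \<Rightarrow> ('s \<Rightarrow> real) \<Rightarrow> bool" where
  "dt_deviation_exists P \<pi> \<longleftrightarrow> (\<forall>i j. summable (\<lambda>n. mat_pow P n i j - \<pi> j))"

definition dt_deviation :: "('s \<Rightarrow> 's \<Rightarrow> real) \<Rightarrow> ('s \<Rightarrow> real) \<Rightarrow> 's \<Rightarrow> 's \<Rightarrow> real" where
  "dt_deviation P \<pi> i j = (\<Sum>n. mat_pow P n i j - \<pi> j)"


section \<open>Continuous time\<close>

text \<open>The time parameter ranges over \<open>{0..}\<close>; values of \<open>X\<close> at negative times are irrelevant.\<close>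

text \<open>The probability of \<open>X t = j\<close> given \<open>X 0 = i\<close>, also written as the entry \<open>(i, j)\<close> of \<open>e\<^bsup>Qt\<^esup>\<close>.\<close>

definition ct_transition ::
    "('s \<Rightarrow> 'w measure) \<Rightarrow> (real \<Rightarrow> 'w \<Rightarrow> 's) \<Rightarrow> real \<Rightarrow> 's \<Rightarrow> 's \<Rightarrow> real" where
  "ct_transition M X t i j = \<P>(\<omega> in M i. X t \<omega> = j)"

text \<open>Paths are right-continuous for the discrete topology on the state space: after each time
  the path stays constant for a while.  The generator \<open>Q\<close> is the entrywise right derivative at 0
  of the transition function.  For chains with such paths it automatically exists, with
  finite entries and zero row sums.\<close>

definition ct_markov_chain ::
    "('s::countable \<Rightarrow> 's \<Rightarrow> real) \<Rightarrow> ('s \<Rightarrow> 'w measure) \<Rightarrow> (real \<Rightarrow> 'w \<Rightarrow> 's) \<Rightarrow> bool" where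
  "ct_markov_chain Q M X \<longleftrightarrow>
     (\<forall>i. prob_space (M i)) \<and>
     (\<forall>i. \<forall>t\<ge>0. X t \<in> M i \<rightarrow>\<^sub>M count_space UNIV) \<and>
     (\<forall>i. AE \<omega> in M i. X 0 \<omega> = i) \<and>
     (\<forall>i. AE \<omega> in M i. \<forall>t\<ge>0. \<forall>\<^sub>F s in at_right t. X s \<omega> = X t \<omega>) \<and>
     (\<forall>i n t x j. 0 \<le> t 0 \<and> (\<forall>k\<le>n. t k < t (Suc k)) \<longrightarrow>
        \<P>(\<omega> in M i. \<forall>k\<le>n. X (t k) \<omega> = x k) > 0 \<longrightarrow>
        \<P>(\<omega> in M i. X (t (Suc n)) \<omega> = j \<bar> \<forall>k\<le>n. X (t k) \<omega> = x k)
          = ct_transition M X (t (Suc n) - t n) (x n) j) \<and>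
     (\<forall>i j. ((\<lambda>h. (ct_transition M X h i j - (if i = j then 1 else 0)) / h) \<longlongrightarrow> Q i j)
              (at_right 0))"

definition ct_irreducible :: "('s \<Rightarrow> 'w measure) \<Rightarrow> (real \<Rightarrow> 'w \<Rightarrow> 's) \<Rightarrow> bool" where
  "ct_irreducible M X \<longleftrightarrow> (\<forall>i j. \<exists>t\<ge>0. ct_transition M X t i j > 0)"

definition ct_hitting_time :: "(real \<Rightarrow> 'w \<Rightarrow> 's) \<Rightarrow> 's \<Rightarrow> 'w \<Rightarrow> ennreal" where
  "ct_hitting_time X j \<omega> = (INF t\<in>{t. 0 \<le> t \<and> X t \<omega> = j}. ennreal t)"

text \<open>First time in \<open>j\<close> after a visit to some other state.\<close>

definition ct_return_time :: "(real \<Rightarrow> 'w \<Rightarrow> 's) \<Rightarrow> 's \<Rightarrow> 'w \<Rightarrow> ennreal" where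
  "ct_return_time X j \<omega> =
     (INF t\<in>{t. 0 \<le> t \<and> X t \<omega> = j \<and> (\<exists>s\<in>{0..t}. X s \<omega> \<noteq> j)}. ennreal t)"

definition ct_mean_hitting ::
    "('s \<Rightarrow> 'w measure) \<Rightarrow> (real \<Rightarrow> 'w \<Rightarrow> 's) \<Rightarrow> 's \<Rightarrow> 's \<Rightarrow> ennreal" where
  "ct_mean_hitting M X i j = (\<integral>\<^sup>+\<omega>. ct_hitting_time X j \<omega> \<partial>M i)"

text \<open>By the usual convention an absorbing state (\<open>Q i i = 0\<close>) is positive recurrent; for
  irreducible chains this only concerns a one-point state space.\<close>

definition ct_positive_recurrent ::
    "('s \<Rightarrow> 's \<Rightarrow> real) \<Rightarrow> ('s \<Rightarrow> 'w measure) \<Rightarrow> (real \<Rightarrow> 'w \<Rightarrow> 's) \<Rightarrow> bool" where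
  "ct_positive_recurrent Q M X \<longleftrightarrow>
     (\<forall>i. Q i i = 0 \<or> (\<integral>\<^sup>+\<omega>. ct_return_time X i \<omega> \<partial>M i) < \<infinity>)"

definition ct_stationary ::
    "('s \<Rightarrow> 'w measure) \<Rightarrow> (real \<Rightarrow> 'w \<Rightarrow> 's) \<Rightarrow> ('s \<Rightarrow> real) \<Rightarrow> bool" where
  "ct_stationary M X \<pi> \<longleftrightarrow>
     prob_dist \<pi> \<and>
     (\<forall>t\<ge>0. \<forall>j. ((\<lambda>i. \<pi> i * ct_transition M X t i j) has_sum \<pi> j) UNIV)"

text \<open>The Henstock-Kurzweil integral over \<open>{0..}\<close> is the (possibly only conditionally
  convergent) improper integral: it exists iff the integrals over \<open>{0..T}\<close> exist and converge as
  \<open>T\<close> tends to infinity, and its value is their limit.\<close>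

definition ct_deviation_exists ::
    "('s \<Rightarrow> 'w measure) \<Rightarrow> (real \<Rightarrow> 'w \<Rightarrow> 's) \<Rightarrow> ('s \<Rightarrow> real) \<Rightarrow> bool" where
  "ct_deviation_exists M X \<pi> \<longleftrightarrow>
     (\<forall>i j. (\<lambda>t. ct_transition M X t i j - \<pi> j) integrable_on {0..})"

definition ct_deviation ::
    "('s \<Rightarrow> 'w measure) \<Rightarrow> (real \<Rightarrow> 'w \<Rightarrow> 's) \<Rightarrow> ('s \<Rightarrow> real) \<Rightarrow> 's \<Rightarrow> 's \<Rightarrow> real" where
  "ct_deviation M X \<pi> i j = integral {0..} (\<lambda>t. ct_transition M X t i j - \<pi> j)"

end

theory Submission
  imports Defs
begin

text \<open>
  Let \<open>m i j\<close> be the mean hitting times and \<open>U i j N\<close> the expected time spent in \<open>j\<close> up to time \<open>N\<close>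
  from \<open>i\<close>.  Decomposing at the hitting time \<open>\<theta>\<close> of \<open>j\<close>, the difference \<open>U j j N - U i j N\<close> is the mean
  of the time spent in \<open>j\<close> during the window \<open>[N - \<theta>, N]\<close> by the chain started in \<open>j\<close>.  As transition
  probabilities converge to \<open>\<pi> j\<close>, Fatou and dominated convergence give the limit \<open>\<pi> j * m i j\<close>,
  finite or not.  Averaging over \<open>i\<close> with weights \<open>\<pi>\<close> turns \<open>U j j N - U i j N\<close> into
  \<open>U j j N - N * \<pi> j\<close>, so that \<open>D j j = \<pi> j * (\<Sum>i. \<pi> i * m i j)\<close>, and the sum of these over \<open>j\<close> is
  the \<open>\<pi>\<close>-mean of \<open>K\<close>.  Fatou also shows that \<open>K\<close> is superharmonic, hence at least its \<open>\<pi>\<close>-mean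
  everywhere, hence constant.

  Continuous time reduces to the skeletons \<open>X (n * h)\<close>: the one with \<open>h = 1\<close> yields superharmonicity,
  and refining the grid yields the first passage decomposition.
\<close>

section \<open>Sums over a countable type as integrals\<close>

text \<open>Neither \<open>D\<close> nor a finite mean hitting time is given in advance, so no
  difference of infinities may ever be formed. This is why everything runs through
  \<open>U j j N - U i j N\<close>: these numbers lie between 0 and \<open>m i j\<close>, and their
  limits exist in [0, \<infinity>] whether or not \<open>m i j\<close> is finite. Real limits are
  recovered only at the end, from \<open>D i j = D j j - \<pi> j * m i j\<close>; if
  \<open>K\<close> is finite then so are both terms on the right, and that is how a nonexistent
  \<open>D\<close> forces \<open>K = \<infinity>\<close>. Constancy of \<open>K\<close> is the
  delicate point. In continuous time \<open>j\<close> may be hit between two skeleton times, so the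
  hitting times obey no exact one-step equation for the skeleton. The occupation times do, and
  passing to the limit in their equation leaves an inequality of the same form for both kinds of
  time. The loss is harmless: a function that is at least its own finite mean cannot exceed it at
  any point that has mass.\<close>

lemma infsum_ennreal_eq_nn_integral:
  fixes f :: "'s::countable \<Rightarrow> ennreal"
  shows "(\<Sum>\<^sub>\<infinity>x. f x) = (\<integral>\<^sup>+x. f x \<partial>count_space UNIV)"
proof (rule antisym)
  have *: "sum f F = (\<integral>\<^sup>+x. f x * indicator F x \<partial>count_space UNIV)" if "finite F" for F
    using that by (simp add: nn_integral_count_space_indicator[symmetric] nn_integral_count_space_finite)
  have "sum f F \<le> (\<integral>\<^sup>+x. f x \<partial>count_space UNIV)" if "finite F" for F
    unfolding *[OF that] by (intro nn_integral_mono) (auto split: split_indicator)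
  then show "(\<Sum>\<^sub>\<infinity>x. f x) \<le> (\<integral>\<^sup>+x. f x \<partial>count_space UNIV)"
    by (subst nonneg_infsum_complete) (auto intro: SUP_least)
  \<comment> \<open>Finite sets that exhaust the countable type along its enumeration, so that
    monotone convergence reaches the whole integral from finite partial sums.\<close>
  define A :: "nat \<Rightarrow> 's set" where "A n = {x. to_nat x < n}" for n
  have fin: "finite (A n)" for n
    using finite_vimageI[of "{..<n}" "to_nat :: 's \<Rightarrow> nat"] by (auto simp: A_def vimage_def)
  have "(\<integral>\<^sup>+x. f x \<partial>count_space UNIV) = (\<integral>\<^sup>+x. (SUP n. f x * indicator (A n) x) \<partial>count_space UNIV)"
  proof (intro nn_integral_cong antisym)
    fix x
    have "f x * indicator (A (Suc (to_nat x))) x = f x" by (auto simp: A_def)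
    then show "f x \<le> (SUP n. f x * indicator (A n) x)" by (metis SUP_upper UNIV_I)
    show "(SUP n. f x * indicator (A n) x) \<le> f x"
      by (intro SUP_least) (auto split: split_indicator)
  qed
  also have "\<dots> = (SUP n. \<integral>\<^sup>+x. f x * indicator (A n) x \<partial>count_space UNIV)"
    by (intro nn_integral_monotone_convergence_SUP)
       (auto simp: incseq_def le_fun_def A_def split: split_indicator)
  also have "\<dots> \<le> (\<Sum>\<^sub>\<infinity>x. f x)"
    unfolding *[OF fin, symmetric]
    by (subst nonneg_infsum_complete) (auto intro!: SUP_mono simp: fin)
  finally show "(\<integral>\<^sup>+x. f x \<partial>count_space UNIV) \<le> (\<Sum>\<^sub>\<infinity>x. f x)" .
qed

lemma infsum_pmf_eq_nn_integral:
  fixes f :: "'s::countable \<Rightarrow> ennreal"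
  shows "(\<Sum>\<^sub>\<infinity>x. ennreal (pmf p x) * f x) = (\<integral>\<^sup>+x. f x \<partial>p)"
  by (simp add: infsum_ennreal_eq_nn_integral nn_integral_measure_pmf)

lemma has_sum_pmf_integral:
  fixes f :: "'s \<Rightarrow> real"
  assumes "integrable (measure_pmf p) f"
  shows "((\<lambda>x. pmf p x * f x) has_sum (\<integral>x. f x \<partial>p)) UNIV"
proof -
  have i: "integrable (count_space UNIV) (\<lambda>x. pmf p x * f x)"
    using assms unfolding measure_pmf_eq_density by (subst (asm) integrable_density) auto
  have e: "(\<integral>x. f x \<partial>p) = (\<integral>x. pmf p x * f x \<partial>count_space UNIV)"
    unfolding measure_pmf_eq_density by (subst integral_density) auto
  have a: "Infinite_Set_Sum.abs_summable_on (\<lambda>x. pmf p x * f x) UNIV"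
    using i by (simp add: abs_summable_on_def)
  have "(\<lambda>x. pmf p x * f x) summable_on UNIV"
    by (rule abs_summable_summable[OF iffD2[OF abs_summable_equivalent a]])
  then show ?thesis
    using e infsetsum_infsum[OF a] by (simp add: infsetsum_def has_sum_infsum)
qed

lemma infsum_pmf_eq_integral:
  fixes f :: "'s \<Rightarrow> real"
  assumes "integrable (measure_pmf p) f"
  shows "(\<Sum>\<^sub>\<infinity>x. pmf p x * f x) = (\<integral>x. f x \<partial>p)"
  using has_sum_pmf_integral[OF assms] by (rule infsumI)

text \<open>An integral against a pmf is a countable weighted sum, so the exchange is countable
  additivity of the integral and holds over any measure \<open>M\<close>.\<close>

lemma nn_integral_pmf_swap:
  fixes p :: "'s::countable pmf"
  assumes "\<And>y. (\<lambda>x. f x y) \<in> borel_measurable M"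
  shows "(\<integral>\<^sup>+x. \<integral>\<^sup>+y. f x y \<partial>p \<partial>M) = (\<integral>\<^sup>+y. \<integral>\<^sup>+x. f x y \<partial>M \<partial>p)"
proof -
  have "(\<integral>\<^sup>+x. \<integral>\<^sup>+y. f x y \<partial>p \<partial>M)
      = (\<integral>\<^sup>+x. \<integral>\<^sup>+y. ennreal (pmf p y) * f x y \<partial>count_space UNIV \<partial>M)"
    by (simp add: nn_integral_measure_pmf)
  also have "\<dots> = (\<integral>\<^sup>+y. \<integral>\<^sup>+x. ennreal (pmf p y) * f x y \<partial>M \<partial>count_space UNIV)"
    using assms by (intro nn_integral_count_space_nn_integral) auto
  also have "\<dots> = (\<integral>\<^sup>+y. \<integral>\<^sup>+x. f x y \<partial>M \<partial>p)"
    using assms by (simp add: nn_integral_measure_pmf nn_integral_cmult)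
  finally show ?thesis .
qed

text \<open>Turns the real families \<open>P i\<close> and \<open>\<pi>\<close> into pmfs, for which
  \<open>bind_pmf\<close> plays the role of the product with a matrix.\<close>

lemma prob_dist_pmfD:
  assumes "prob_dist q"
  shows "\<exists>p. pmf p = q"
proof -
  have nonneg: "\<And>x. 0 \<le> q x" and s: "(q has_sum 1) UNIV"
    using assms by (auto simp: prob_dist_def)
  have "Infinite_Set_Sum.abs_summable_on q UNIV"
    using has_sum_imp_summable[OF s] nonneg
    by (simp flip: abs_summable_equivalent)
  then have i: "integrable (count_space UNIV) q" and e: "infsetsum q UNIV = 1"
    using infsumI[OF s] infsetsum_infsum[of q UNIV] by (auto simp: abs_summable_on_def infsetsum_def)
  have "(\<integral>\<^sup>+x. ennreal (q x) \<partial>count_space UNIV) = 1"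
    using i e nonneg by (subst nn_integral_eq_integral) (auto simp: infsetsum_def)
  then show ?thesis
    using nonneg by (intro exI[of _ "embed_pmf q"] ext pmf_embed_pmf) auto
qed

lemma integrable_pmf_bounded:
  fixes f :: "'s \<Rightarrow> real"
  assumes "\<And>x. \<bar>f x\<bar> \<le> B"
  shows "integrable (measure_pmf p) f"
  using assms by (intro measure_pmf.integrable_const_bound[where B=B]) auto

lemma integral_bind_pmf_bounded:
  fixes f :: "'s \<Rightarrow> real"
  assumes "\<And>x. \<bar>f x\<bar> \<le> B"
  shows "(\<integral>y. f y \<partial>bind_pmf p k) = (\<integral>x. \<integral>y. f y \<partial>k x \<partial>p)"
proof -
  have "(\<integral>y. f y \<partial>measure_pmf p \<bind> (\<lambda>x. measure_pmf (k x))) = (\<integral>x. \<integral>y. f y \<partial>k x \<partial>p)"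
  proof (rule integral_bind[where K="count_space UNIV" and B'=1 and B=B])
    show "(\<lambda>x. measure_pmf (k x)) \<in> measurable (measure_pmf p) (subprob_algebra (count_space UNIV))"
      using measurable_measure_pmf[of k] by simp
    show "finite_measure (measure_pmf p)" by (rule measure_pmf.finite_measure)
    show "AE x in measure_pmf p. emeasure (measure_pmf (k x)) (space (measure_pmf (k x))) \<le> ennreal 1"
      using measure_pmf.emeasure_space_1 by (simp add: measure_pmf.emeasure_space_1 del: space_measure_pmf)
  qed (use assms in auto)
  then show ?thesis by (simp add: measure_pmf_bind)
qed

section \<open>Convergence to the stationary distribution\<close>

text \<open>The law after \<open>n\<close> steps; the new step is put in front, as in the recursion
  of \<open>mat_pow\<close>.\<close>

primrec kpow :: "('s \<Rightarrow> 's pmf) \<Rightarrow> nat \<Rightarrow> 's \<Rightarrow> 's pmf" where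
  "kpow \<kappa> 0 = return_pmf"
| "kpow \<kappa> (Suc n) = (\<lambda>i. bind_pmf (\<kappa> i) (kpow \<kappa> n))"

lemma kpow_add: "kpow \<kappa> (m + n) i = bind_pmf (kpow \<kappa> m i) (kpow \<kappa> n)"
proof (induction m arbitrary: i)
  case 0
  then show ?case by (simp add: bind_return_pmf)
next
  case (Suc m)
  then have "kpow \<kappa> (m + n) = (\<lambda>i. bind_pmf (kpow \<kappa> m i) (kpow \<kappa> n))" by blast
  then show ?case by (simp add: bind_assoc_pmf)
qed

lemma kpow_1: "kpow \<kappa> (Suc 0) i = \<kappa> i"
  by (simp add: bind_return_pmf')

lemma kpow_stationary:
  assumes "bind_pmf q \<kappa> = q"
  shows "bind_pmf q (kpow \<kappa> n) = q"
proof (induction n)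
  case 0
  then show ?case by (simp add: bind_return_pmf')
next
  case (Suc n)
  have "bind_pmf q (kpow \<kappa> (Suc n)) = bind_pmf (bind_pmf q \<kappa>) (kpow \<kappa> n)"
    by (simp add: bind_assoc_pmf)
  with Suc assms show ?case by simp
qed

text \<open>One summand of the Chapman-Kolmogorov sum over the state at time
  \<open>m\<close>.\<close>

lemma pmf_kpow_mult_le: "pmf (kpow \<kappa> m i) k * pmf (kpow \<kappa> n k) j \<le> pmf (kpow \<kappa> (m + n) i) j"
proof -
  have "ennreal (pmf (kpow \<kappa> m i) k * pmf (kpow \<kappa> n k) j)
      = (\<integral>\<^sup>+x. ennreal (pmf (kpow \<kappa> n k) j) * indicator {k} x \<partial>kpow \<kappa> m i)"
    by (subst nn_integral_cmult_indicator) (auto simp: emeasure_pmf_single ennreal_mult mult.commute)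
  also have "\<dots> \<le> (\<integral>\<^sup>+x. ennreal (pmf (kpow \<kappa> n x) j) \<partial>kpow \<kappa> m i)"
    by (intro nn_integral_mono) (auto split: split_indicator)
  also have "\<dots> = ennreal (pmf (kpow \<kappa> (m + n) i) j)"
    by (simp add: kpow_add ennreal_pmf_bind)
  finally show ?thesis by simp
qed

lemma mat_pow_eq_pmf_kpow:
  assumes "\<And>i. pmf (\<kappa> i) = P i"
  shows "mat_pow P n i j = pmf (kpow \<kappa> n i) j"
proof (induction n arbitrary: i)
  case 0
  then show ?case by (simp add: pmf_return indicator_def)
next
  case (Suc n)
  have "mat_pow P (Suc n) i j = (\<Sum>\<^sub>\<infinity>k. pmf (\<kappa> i) k * pmf (kpow \<kappa> n k) j)"
    using assms by (simp add: Suc)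
  also have "\<dots> = pmf (kpow \<kappa> (Suc n) i) j"
    by (subst infsum_pmf_eq_integral)
       (auto simp: pmf_bind pmf_le_1 intro!: integrable_pmf_bounded[where B=1])
  finally show ?case .
qed

lemma pmf_mult_le_integral:
  fixes f :: "'s \<Rightarrow> real"
  assumes "integrable (measure_pmf p) f" "\<And>x. 0 \<le> f x"
  shows "pmf p x * f x \<le> (\<integral>y. f y \<partial>p)"
proof -
  have "pmf p x * f x = (\<integral>y. f x * indicator {x} y \<partial>p)"
    by (simp add: measure_pmf_single)
  also have "\<dots> \<le> (\<integral>y. f y \<partial>p)"
  proof (rule integral_mono)
    show "integrable (measure_pmf p) (\<lambda>y. f x * indicator {x} y)"
      using assms by (intro integrable_pmf_bounded[where B="f x"]) (auto split: split_indicator)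
  qed (use assms in \<open>auto split: split_indicator\<close>)
  finally show ?thesis .
qed

text \<open>The sums \<open>S n = \<Sum>i. \<pi> i * (p n i j)\<^sup>2\<close> decrease, and \<open>S n - S (r + n)\<close> is the \<open>\<pi>\<close>-mean over \<open>i\<close> of the
  variance of \<open>p n _ j\<close> under the law \<open>p r i\<close>.  As these variances vanish in the limit, \<open>p n k j\<close> and
  \<open>p n k' j\<close> become equal when \<open>k\<close> and \<open>k'\<close> can both be reached in \<open>r\<close> steps from one \<open>i\<close>.\<close>

theorem pmf_kpow_tendsto_stationary:
  fixes \<kappa> :: "'s \<Rightarrow> 's pmf"
  assumes st: "bind_pmf q \<kappa> = q" and pos: "\<And>i. 0 < pmf q i"
    and meet: "\<And>k k'. \<exists>i r. 0 < pmf (kpow \<kappa> r i) k \<and> 0 < pmf (kpow \<kappa> r i) k'"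
  shows "(\<lambda>n. pmf (kpow \<kappa> n i) j) \<longlonglongrightarrow> pmf q j"
proof -
  define F where "F n k = pmf (kpow \<kappa> n k) j" for n k
  have F01: "0 \<le> F n k" "F n k \<le> 1" for n k by (auto simp: F_def pmf_le_1)
  have sq1: "\<bar>(x - y)\<^sup>2\<bar> \<le> 1" if "0 \<le> x" "x \<le> 1" "0 \<le> y" "y \<le> 1" for x y :: real
    using that by (simp add: power_le_one_iff abs_le_square_iff abs_square_le_1)
  have int1: "integrable (measure_pmf p) (\<lambda>k. F n k)" for p n
    using F01 by (intro integrable_pmf_bounded[where B=1]) auto
  have int2: "integrable (measure_pmf p) (\<lambda>k. (F n k)\<^sup>2)" for p n
    using F01 by (intro integrable_pmf_bounded[where B=1]) (auto simp: power_le_one)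
  have int3: "integrable (measure_pmf p) (\<lambda>k. (F n k - F m i)\<^sup>2)" for p n m i
    using F01 by (intro integrable_pmf_bounded[where B=1] sq1)
  have step: "F (r + n) i = (\<integral>k. F n k \<partial>kpow \<kappa> r i)" for r n i
    by (simp add: F_def kpow_add pmf_bind)
  define S where "S n = (\<integral>k. (F n k)\<^sup>2 \<partial>q)" for n
  define V where "V r n i = (\<integral>k. (F n k - F (r + n) i)\<^sup>2 \<partial>kpow \<kappa> r i)" for r n i
  have V: "V r n i = (\<integral>k. (F n k)\<^sup>2 \<partial>kpow \<kappa> r i) - (F (r + n) i)\<^sup>2" for r n i
  proof -
    have "V r n i = (\<integral>k. (F n k)\<^sup>2 - 2 * F (r + n) i * F n k + (F (r + n) i)\<^sup>2 \<partial>kpow \<kappa> r i)"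
      unfolding V_def by (intro Bochner_Integration.integral_cong) (auto simp: power2_eq_square algebra_simps)
    also have "\<dots> = (\<integral>k. (F n k)\<^sup>2 \<partial>kpow \<kappa> r i) - 2 * F (r + n) i * F (r + n) i + (F (r + n) i)\<^sup>2"
      using int1 int2 by (simp add: step[of r n i])
    finally show ?thesis by (simp add: power2_eq_square)
  qed
  have Vnn: "0 \<le> V r n i" for r n i
    unfolding V_def by (intro integral_nonneg_AE) auto
  have bnd: "\<bar>\<integral>k. (F n k)\<^sup>2 \<partial>kpow \<kappa> r i\<bar> \<le> 1" for r n i
  proof -
    have "(\<integral>k. (F n k)\<^sup>2 \<partial>kpow \<kappa> r i) \<le> (\<integral>k. 1 \<partial>kpow \<kappa> r i)"
      using F01 by (intro integral_mono int2) (auto simp: power_le_one)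
    moreover have "0 \<le> (\<integral>k. (F n k)\<^sup>2 \<partial>kpow \<kappa> r i)" by (intro integral_nonneg_AE) auto
    ultimately show ?thesis by simp
  qed
  have intV: "integrable (measure_pmf q) (V r n)" for r n
  proof (rule integrable_pmf_bounded[where B=1])
    show "\<bar>V r n i\<bar> \<le> 1" for i
      using Vnn[of r n i] bnd[where n=n and r=r and i=i] zero_le_power2[of "F (r + n) i"]
      unfolding V by linarith
  qed
  have drop: "S n - S (r + n) = (\<integral>i. V r n i \<partial>q)" for r n
  proof -
    \<comment> \<open>By stationarity \<open>q\<close> may be replaced by the law after
      \<open>r\<close> steps, which makes \<open>S n\<close> a mean of second moments; subtracting
      the squared means leaves variances.\<close>
    have "S n = (\<integral>k. (F n k)\<^sup>2 \<partial>bind_pmf q (kpow \<kappa> r))"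
      by (simp add: S_def kpow_stationary[OF st])
    also have "\<dots> = (\<integral>i. \<integral>k. (F n k)\<^sup>2 \<partial>kpow \<kappa> r i \<partial>q)"
      using F01 by (intro integral_bind_pmf_bounded[where B=1]) (auto simp: power_le_one)
    finally show ?thesis
      unfolding V S_def using int2 bnd
      by (subst Bochner_Integration.integral_diff) (auto intro!: integrable_pmf_bounded[where B=1])
  qed
  have "decseq S"
    unfolding decseq_Suc_iff
  proof
    fix n show "S (Suc n) \<le> S n"
    proof -
      have "0 \<le> (\<integral>i. V 1 n i \<partial>q)" using Vnn by (intro Bochner_Integration.integral_nonneg)
      then show ?thesis using drop[of n 1] by simp
    qed
  qed
  moreover have "0 \<le> S n" for n unfolding S_def by (intro integral_nonneg_AE) auto
  ultimately obtain L where L: "S \<longlonglongrightarrow> L" using decseq_convergent[of S 0] by metis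
  have dropz: "(\<lambda>n. S n - S (r + n)) \<longlonglongrightarrow> 0" for r
    using tendsto_diff[OF L LIMSEQ_ignore_initial_segment[OF L, of r]] by (simp add: add.commute)
  have close: "(\<lambda>n. F n k - F (r + n) i) \<longlonglongrightarrow> 0" if r: "0 < pmf (kpow \<kappa> r i) k" for r i k
  proof -
    \<comment> \<open>The weight of the pair \<open>(i, k)\<close> in the double average that forms
      \<open>S n - S (r + n)\<close>.\<close>
    define c where "c = pmf q i * pmf (kpow \<kappa> r i) k"
    have c: "0 < c" using r pos by (simp add: c_def)
    have le: "(F n k - F (r + n) i)\<^sup>2 \<le> (S n - S (r + n)) / c" for n
    proof -
      have "pmf (kpow \<kappa> r i) k * (F n k - F (r + n) i)\<^sup>2 \<le> V r n i"
        unfolding V_def using int3 by (intro pmf_mult_le_integral) auto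
      then have "c * (F n k - F (r + n) i)\<^sup>2 \<le> pmf q i * V r n i"
        by (simp add: c_def mult.assoc mult_left_mono)
      also have "\<dots> \<le> S n - S (r + n)"
        unfolding drop using intV Vnn by (intro pmf_mult_le_integral) auto
      finally show ?thesis using c by (simp add: pos_le_divide_eq mult.commute)
    qed
    have *: "(\<lambda>n. (S n - S (r + n)) / c) \<longlonglongrightarrow> 0"
      using tendsto_divide_zero[OF dropz] by simp
    have "(\<lambda>n. (F n k - F (r + n) i)\<^sup>2) \<longlonglongrightarrow> 0"
      by (rule tendsto_sandwich[OF always_eventually always_eventually tendsto_const *]) (auto simp: le)
    then show ?thesis by (simp add: power_tendsto_0_iff)
  qed
  have diff: "(\<lambda>n. F n i - F n k) \<longlonglongrightarrow> 0" for k
  proof -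
    \<comment> \<open>Both \<open>F n i\<close> and \<open>F n k\<close> approach the same
      \<open>F (r + n) l\<close>, which cancels.\<close>
    obtain l r where "0 < pmf (kpow \<kappa> r l) i" "0 < pmf (kpow \<kappa> r l) k" using meet by blast
    from tendsto_diff[OF close[OF this(1)] close[OF this(2)]] show ?thesis by simp
  qed
  \<comment> \<open>Averaging over \<open>k\<close> is allowed by boundedness, and stationarity
    makes the mean of \<open>F n k\<close> equal to \<open>pmf q j\<close> for every
    \<open>n\<close>.\<close>
  have "(\<lambda>n. \<integral>k. F n i - F n k \<partial>q) \<longlonglongrightarrow> (\<integral>k. 0 \<partial>q)"
  proof (rule integral_dominated_convergence[where w="\<lambda>_. 1"])
    have "\<bar>F n i - F n k\<bar> \<le> 1" for n k
      using F01[of n i] F01[of n k] by linarith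
    then show "AE k in q. norm (F n i - F n k) \<le> 1" for n by simp
  qed (use diff in auto)
  moreover have "(\<integral>k. F n i - F n k \<partial>q) = F n i - pmf q j" for n
    using int1 arg_cong[OF kpow_stationary[OF st, of n], of "\<lambda>p. pmf p j"] by (simp add: F_def pmf_bind)
  ultimately show ?thesis by (simp add: F_def LIM_zero_iff)
qed

text \<open>The differences of elements of \<open>A\<close> form a group of integers, whose positive generator divides
  every element of \<open>A\<close>.\<close>

lemma Gcd_1_imp_difference:
  fixes A :: "nat set"
  assumes zero: "0 \<in> A" and add: "\<And>x y. x \<in> A \<Longrightarrow> y \<in> A \<Longrightarrow> x + y \<in> A" and gcd: "Gcd A = 1"
  shows "\<exists>x\<in>A. \<exists>y\<in>A. x = a + y"
proof -
  define G where "G = {d. \<exists>x\<in>A. \<exists>y\<in>A. x = d + y}"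
  have AG: "A \<subseteq> G" using zero by (force simp: G_def)
  have mul: "d * n \<in> G" if d: "d \<in> G" for d n
  proof (induction n)
    case 0
    then show ?case using zero AG by auto
  next
    case (Suc n)
    obtain x y x' y' where "x \<in> A" "y \<in> A" "x = d + y" "x' \<in> A" "y' \<in> A" "x' = d * n + y'"
      using d Suc by (auto simp: G_def)
    then have "x + x' \<in> A" "y + y' \<in> A" "x + x' = d * Suc n + (y + y')" using add by auto
    then show ?case unfolding G_def by blast
  qed
  have diff: "c - d \<in> G" if cd: "c \<in> G" "d \<in> G" "d \<le> c" for c d
  proof -
    obtain x y x' y' where "x \<in> A" "y \<in> A" "x = c + y" "x' \<in> A" "y' \<in> A" "x' = d + y'"
      using cd by (auto simp: G_def)
    then have "x + y' \<in> A" "y + x' \<in> A" "x + y' = (c - d) + (y + x')" using add cd by auto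
    then show ?thesis unfolding G_def by blast
  qed
  \<comment> \<open>The Gcd of \<open>{0}\<close> is 0, so \<open>A\<close> has a positive
    element.\<close>
  have "A \<noteq> {0}" using gcd by auto
  then have ex: "\<exists>d. d \<in> G \<and> 0 < d" using AG zero by auto
  define d where "d = (LEAST d. d \<in> G \<and> 0 < d)"
  have d: "d \<in> G" "0 < d" using LeastI_ex[OF ex] by (auto simp: d_def)
  have "d dvd x" if "x \<in> A" for x
  proof -
    have "x - d * (x div d) \<in> G" using that AG d by (intro diff mul) auto
    then have "x mod d \<in> G" by (simp add: minus_mult_div_eq_mod)
    moreover have "x mod d < d" using d by simp
    ultimately have "\<not> 0 < x mod d" using not_less_Least[of "x mod d" "\<lambda>d. d \<in> G \<and> 0 < d", folded d_def] by auto
    then show ?thesis by (simp add: mod_eq_0_iff_dvd)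
  qed
  then have "d dvd Gcd A" by (rule Gcd_greatest)
  then have "d = 1" using gcd by simp
  then have "a \<in> G" using mul[OF d(1), of a] by simp
  then show ?thesis by (auto simp: G_def)
qed

text \<open>Return times to \<open>k\<close> have differences of every size, hence of the length
  \<open>a\<close> of a passage from \<open>k\<close> to \<open>k'\<close>. With
  \<open>x = a + y\<close>, a walk of \<open>x\<close> steps from \<open>k\<close> can end in
  \<open>k\<close>, or loop for \<open>y\<close> steps and then go to \<open>k'\<close> in
  \<open>a\<close>; so \<open>k\<close> itself is the common starting state.\<close>

lemma aperiodic_meet:
  assumes irr: "\<And>i j. \<exists>n. 0 < pmf (kpow \<kappa> n i) j"
    and aper: "\<And>i. Gcd {n. 0 < n \<and> 0 < pmf (kpow \<kappa> n i) i} = 1"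
  shows "\<exists>i r. 0 < pmf (kpow \<kappa> r i) k \<and> 0 < pmf (kpow \<kappa> r i) k'"
proof -
  define A where "A = {n. 0 < pmf (kpow \<kappa> n k) k}"
  have trans: "0 < pmf (kpow \<kappa> (m + n) i) j" if "0 < pmf (kpow \<kappa> m i) l" "0 < pmf (kpow \<kappa> n l) j" for m n i l j
    using pmf_kpow_mult_le[of \<kappa> m i l n j] that by (smt (verit) mult_pos_pos)
  obtain a where a: "0 < pmf (kpow \<kappa> a k) k'" using irr by blast
  have "0 \<in> A" by (simp add: A_def)
  \<comment> \<open>Adding the return time 0 leaves the Gcd unchanged and supplies the zero that the
    difference lemma asks for.\<close>
  moreover have "A = insert 0 {n. 0 < n \<and> 0 < pmf (kpow \<kappa> n k) k}"
    by (auto simp: A_def)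
  then have "Gcd A = 1" using aper[of k] by simp
  ultimately obtain x y where xy: "x \<in> A" "y \<in> A" "x = a + y"
    using Gcd_1_imp_difference[of A a] trans by (auto simp: A_def)
  then have "0 < pmf (kpow \<kappa> x k) k" "0 < pmf (kpow \<kappa> x k) k'"
    using trans[of y k k a k'] a by (auto simp: A_def add.commute)
  then show ?thesis by blast
qed

text \<open>One statement for finite and infinite means: if the integral of \<open>w\<close> is
  finite, \<open>w\<close> dominates; otherwise the limit is \<infinity> and Fatou pushes the
  integrals there. The second case would break for \<open>c = 0\<close>, since
  \<open>0 * \<infinity> = 0\<close>.\<close>

lemma nn_integral_tendsto_cmult:
  fixes c :: ennreal
  assumes [measurable]: "\<And>n. f n \<in> borel_measurable M" "w \<in> borel_measurable M"
    and le: "\<And>n. AE x in M. f n x \<le> w x"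
    and lim: "AE x in M. (\<lambda>n. f n x) \<longlonglongrightarrow> c * w x"
    and c: "c \<noteq> 0"
  shows "(\<lambda>n. \<integral>\<^sup>+x. f n x \<partial>M) \<longlonglongrightarrow> c * (\<integral>\<^sup>+x. w x \<partial>M)"
proof (cases "(\<integral>\<^sup>+x. w x \<partial>M) < \<infinity>")
  case True
  have "(\<lambda>n. \<integral>\<^sup>+x. f n x \<partial>M) \<longlonglongrightarrow> (\<integral>\<^sup>+x. c * w x \<partial>M)"
    using True le lim by (intro nn_integral_dominated_convergence[where w=w]) auto
  then show ?thesis by (simp add: nn_integral_cmult)
next
  case False
  then have top: "c * (\<integral>\<^sup>+x. w x \<partial>M) = \<infinity>" using c by (simp add: not_less top_unique ennreal_mult_top)
  have "(\<integral>\<^sup>+x. c * w x \<partial>M) = (\<integral>\<^sup>+x. liminf (\<lambda>n. f n x) \<partial>M)"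
    using lim by (intro nn_integral_cong_AE) (auto elim!: eventually_mono simp: lim_imp_Liminf)
  also have "\<dots> \<le> liminf (\<lambda>n. \<integral>\<^sup>+x. f n x \<partial>M)"
    by (intro nn_integral_liminf) auto
  finally have "liminf (\<lambda>n. \<integral>\<^sup>+x. f n x \<partial>M) = \<infinity>"
    using top by (simp add: nn_integral_cmult top_unique)
  moreover have "liminf (\<lambda>n. \<integral>\<^sup>+x. f n x \<partial>M) \<le> limsup (\<lambda>n. \<integral>\<^sup>+x. f n x \<partial>M)"
    by (intro Liminf_le_Limsup) auto
  ultimately show ?thesis
    unfolding top by (subst tendsto_iff_Liminf_eq_Limsup) (auto simp: top_unique)
qed

lemma ennreal_sum_summable_iff:
  fixes f :: "'s::countable \<Rightarrow> real"
  assumes "\<And>x. 0 \<le> f x"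
  shows "f summable_on UNIV \<longleftrightarrow> (\<integral>\<^sup>+x. ennreal (f x) \<partial>count_space UNIV) < \<infinity>"
    and "f summable_on UNIV \<Longrightarrow> (\<integral>\<^sup>+x. ennreal (f x) \<partial>count_space UNIV) = ennreal (\<Sum>\<^sub>\<infinity>x. f x)"
proof -
  have eq: "f summable_on UNIV \<longleftrightarrow> Infinite_Set_Sum.abs_summable_on f UNIV"
    using abs_summable_equivalent[of f UNIV] assms by simp
  then show "f summable_on UNIV \<longleftrightarrow> (\<integral>\<^sup>+x. ennreal (f x) \<partial>count_space UNIV) < \<infinity>"
    using assms by (simp add: abs_summable_on_def integrable_iff_bounded)
  assume "f summable_on UNIV"
  then have a: "Infinite_Set_Sum.abs_summable_on f UNIV" using eq by simp
  then show "(\<integral>\<^sup>+x. ennreal (f x) \<partial>count_space UNIV) = ennreal (\<Sum>\<^sub>\<infinity>x. f x)"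
    using assms unfolding infsetsum_infsum[OF a, symmetric] infsetsum_def abs_summable_on_def
    by (intro nn_integral_eq_integral) auto
qed

lemma nn_integral_pmf_finite_imp:
  assumes "(\<integral>\<^sup>+x. f x \<partial>measure_pmf p) < \<infinity>" "0 < pmf p x"
  shows "f x < \<infinity>"
proof (rule ccontr)
  assume "\<not> f x < \<infinity>"
  then have "f x = \<infinity>" by (simp add: not_less top_unique)
  then have "(\<integral>\<^sup>+y. \<infinity> * indicator {x} y \<partial>p) \<le> (\<integral>\<^sup>+y. f y \<partial>p)"
    by (intro nn_integral_mono) (auto split: split_indicator)
  moreover have "(\<integral>\<^sup>+y. \<infinity> * indicator {x} y \<partial>p) = \<infinity>"
    using assms(2) by (subst nn_integral_cmult_indicator) (auto simp: emeasure_pmf_single ennreal_top_mult)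
  ultimately show False
    using assms(1) by (simp add: top_unique)
qed

section \<open>The Kemeny sum from expected occupation times\<close>

text \<open>\<open>U i j N\<close> plays the role of the expected time spent in \<open>j\<close> up to time \<open>N\<close> when starting
  from \<open>i\<close>, and \<open>m i j\<close> that of the mean hitting time.  In continuous time, \<open>\<kappa>\<close> is the transition
  kernel at time \<open>1\<close>.\<close>

locale occupation =
  fixes \<kappa> :: "'s::countable \<Rightarrow> 's pmf" and q :: "'s pmf"
    and U :: "'s \<Rightarrow> 's \<Rightarrow> nat \<Rightarrow> real" and m :: "'s \<Rightarrow> 's \<Rightarrow> ennreal"
  assumes pos: "0 < pmf q j"
    and kpow_lim: "(\<lambda>n. pmf (kpow \<kappa> n i) j) \<longlonglongrightarrow> pmf q j"
    and U_nonneg: "0 \<le> U i j N" and U_le: "U i j N \<le> real N"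
    and U_mono: "U i j N \<le> U i j (Suc N)"
    and U_step: "(\<integral>k. U k j N \<partial>\<kappa> i) = U i j (Suc N) - U i j 1"
    and U_inc: "(\<lambda>N. U i j (Suc N) - U i j N) \<longlonglongrightarrow> pmf q j"
    and U_mass: "(\<integral>\<^sup>+j. ennreal (U i j 1) \<partial>count_space UNIV) = 1"
    and U_stat: "(\<integral>i. U i j N \<partial>q) = real N * pmf q j"
    and U_le_diag: "U i j N \<le> U j j N"
    and m_ge: "ennreal (U j j N - U i j N) \<le> m i j"
    and m_lim: "(\<lambda>N. ennreal (U j j N - U i j N)) \<longlonglongrightarrow> ennreal (pmf q j) * m i j"
begin

definition K :: "'s \<Rightarrow> ennreal" where "K i = (\<integral>\<^sup>+j. m i j \<partial>q)"

text \<open>The value of \<open>D j j\<close> when \<open>D\<close> exists, in a form that makes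
  sense in [0, \<infinity>] beforehand.\<close>

definition d :: "'s \<Rightarrow> ennreal" where "d j = ennreal (pmf q j) * (\<integral>\<^sup>+i. m i j \<partial>q)"

lemma integrable_U: "integrable (measure_pmf p) (\<lambda>k. U k j N)"
  using U_nonneg U_le by (intro integrable_pmf_bounded[where B="real N"]) auto

lemma m_diag: "m j j = 0"
proof -
  have "(\<lambda>N. ennreal (U j j N - U j j N)) \<longlonglongrightarrow> 0" by simp
  from LIMSEQ_unique[OF m_lim this] show ?thesis using pos[of j] by simp
qed

text \<open>The shift \<open>c\<close> is 0 in \<open>d_lim\<close> and an increment of
  \<open>U i j\<close> in \<open>m_step\<close>; \<open>U_le_diag\<close> keeps the integrand
  nonnegative, so the Bochner integral can be used.\<close>

lemma nn_integral_U:
  "(\<integral>\<^sup>+k. ennreal (U j j N - U k j N + c) \<partial>measure_pmf p) = ennreal (U j j N - (\<integral>k. U k j N \<partial>p) + c)"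
  if "0 \<le> c"
  using integrable_U that U_le_diag[of _ j N]
  by (subst nn_integral_eq_integral) (auto intro!: integrable_U AE_I2 add_nonneg_nonneg)

text \<open>\<open>U_le_diag\<close> averaged over the stationary law. It makes the sequence of
  \<open>d_lim\<close> nonnegative, so that its limit can be read in the reals, and gives
  \<open>0 \<le> D j j\<close>.\<close>

lemma U_stat_le: "real N * pmf q j \<le> U j j N"
proof -
  have "(\<integral>k. U k j N \<partial>q) \<le> (\<integral>k. U j j N \<partial>q)"
    by (intro integral_mono integrable_U) (auto intro: U_le_diag)
  then show ?thesis by (simp add: U_stat)
qed

lemma d_lim: "(\<lambda>N. ennreal (U j j N - real N * pmf q j)) \<longlonglongrightarrow> d j"
proof -
  have "(\<lambda>N. \<integral>\<^sup>+i. ennreal (U j j N - U i j N) \<partial>q) \<longlonglongrightarrow> d j"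
    unfolding d_def using m_ge m_lim pos[of j] by (intro nn_integral_tendsto_cmult) auto
  then show ?thesis using nn_integral_U[where c=0 and p=q and j=j] by (simp add: U_stat)
qed

text \<open>A one-step inequality: \<open>\<pi> j * m i j\<close> exceeds its mean under \<open>\<kappa> i\<close> by at least
  \<open>\<pi> j - U i j 1\<close>, and these numbers sum to \<open>0\<close> over \<open>j\<close>.\<close>

lemma m_step:
  "(\<integral>\<^sup>+k. ennreal (pmf q j) * m k j \<partial>\<kappa> i) + ennreal (pmf q j) \<le> ennreal (pmf q j) * m i j + ennreal (U i j 1)"
proof -
  \<comment> \<open>By \<open>U_step\<close> the mean of \<open>U j j N - U k j N\<close> under
    \<open>\<kappa> i\<close> contains \<open>U i j (Suc N)\<close>. The added increment brings it
    back to \<open>U i j N\<close>, to which \<open>m_lim\<close> applies; it is itself nonnegative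
    with limit \<open>pmf q j\<close>.\<close>
  define G where "G N k = ennreal (U j j N - U k j N + (U i j (Suc N) - U i j N))" for N k
  have G: "(\<lambda>N. G N k) \<longlonglongrightarrow> ennreal (pmf q j) * m k j + ennreal (pmf q j)" for k
  proof -
    have "(\<lambda>N. ennreal (U j j N - U k j N) + ennreal (U i j (Suc N) - U i j N))
        \<longlonglongrightarrow> ennreal (pmf q j) * m k j + ennreal (pmf q j)"
      by (intro tendsto_add m_lim tendsto_ennrealI U_inc)
    then show ?thesis by (simp add: G_def U_le_diag U_mono flip: ennreal_plus)
  qed
  have "(\<lambda>N. ennreal (U j j N - U i j N) + ennreal (U i j 1))
      \<longlonglongrightarrow> ennreal (pmf q j) * m i j + ennreal (U i j 1)"
    by (intro tendsto_add m_lim tendsto_const)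
  moreover have "ennreal (U j j N - U i j N) + ennreal (U i j 1) = (\<integral>\<^sup>+k. G N k \<partial>\<kappa> i)" for N
    using U_mono[of i j N] U_le_diag[of i j N] U_nonneg[of i j 1]
    by (simp add: G_def nn_integral_U U_step flip: ennreal_plus)
  ultimately have lim: "(\<lambda>N. \<integral>\<^sup>+k. G N k \<partial>\<kappa> i) \<longlonglongrightarrow> ennreal (pmf q j) * m i j + ennreal (U i j 1)"
    by simp
  have "(\<integral>\<^sup>+k. ennreal (pmf q j) * m k j + ennreal (pmf q j) \<partial>\<kappa> i) = (\<integral>\<^sup>+k. liminf (\<lambda>N. G N k) \<partial>\<kappa> i)"
    by (simp add: lim_imp_Liminf[OF trivial_limit_sequentially G] cong: nn_integral_cong)
  also have "\<dots> \<le> liminf (\<lambda>N. \<integral>\<^sup>+k. G N k \<partial>\<kappa> i)" by (intro nn_integral_liminf) auto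
  also have "\<dots> = ennreal (pmf q j) * m i j + ennreal (U i j 1)"
    using lim by (intro lim_imp_Liminf) auto
  finally show ?thesis by (simp add: nn_integral_add)
qed

text \<open>Start at \<open>j\<close>, where \<open>m j j = 0\<close>: each use of
  \<open>m_step\<close> raises the mean by at most \<open>U i j 1 \<le> 1\<close>, so after
  \<open>n\<close> steps it is at most \<open>n\<close>. Every \<open>k\<close> has positive
  probability for some \<open>n\<close>, so it cannot carry an infinite value.\<close>

lemma m_finite: "m k j < \<infinity>"
proof -
  have *: "(\<integral>\<^sup>+k. ennreal (pmf q j) * m k j \<partial>kpow \<kappa> n i) \<le> ennreal (pmf q j) * m i j + of_nat n" for n i
  proof (induction n arbitrary: i)
    case 0
    then show ?case by (simp add: nn_integral_return)
  next
    case (Suc n)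
    have "(\<integral>\<^sup>+k. ennreal (pmf q j) * m k j \<partial>kpow \<kappa> (Suc n) i)
        \<le> (\<integral>\<^sup>+k. ennreal (pmf q j) * m k j + of_nat n \<partial>\<kappa> i)"
      using Suc by (simp add: nn_integral_mono)
    also have "\<dots> = (\<integral>\<^sup>+k. ennreal (pmf q j) * m k j \<partial>\<kappa> i) + of_nat n"
      by (simp add: nn_integral_add)
    also have "(\<integral>\<^sup>+k. ennreal (pmf q j) * m k j \<partial>\<kappa> i) \<le> ennreal (pmf q j) * m i j + ennreal (U i j 1)"
      by (rule order_trans[OF _ m_step]) simp
    also have "ennreal (U i j 1) \<le> 1" using U_le[of i j 1] by simp
    finally show ?case by (simp add: ac_simps add_mono)
  qed
  have "\<forall>\<^sub>F n in sequentially. 0 < pmf (kpow \<kappa> n j) k"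
    using order_tendstoD(1)[OF kpow_lim pos] .
  then obtain n where n: "0 < pmf (kpow \<kappa> n j) k" by (auto simp: eventually_sequentially)
  have "(\<integral>\<^sup>+k. ennreal (pmf q j) * m k j \<partial>kpow \<kappa> n j) < \<infinity>"
    using *[of n j] by (simp add: m_diag) (metis ennreal_of_nat_neq_top order_le_less_trans top.not_eq_extremum)
  from nn_integral_pmf_finite_imp[OF this n] show ?thesis
    using pos[of j] by (auto simp: ennreal_mult_less_top)
qed

lemma K_superharmonic: "(\<integral>\<^sup>+k. K k \<partial>\<kappa> i) \<le> K i"
proof -
  have "(\<integral>\<^sup>+k. K k \<partial>\<kappa> i) = (\<integral>\<^sup>+j. (\<integral>\<^sup>+k. m k j \<partial>\<kappa> i) \<partial>q)"
    unfolding K_def by (rule nn_integral_pmf_swap) simp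
  also have "\<dots> = (\<integral>\<^sup>+j. (\<integral>\<^sup>+k. ennreal (pmf q j) * m k j \<partial>\<kappa> i) \<partial>count_space UNIV)"
    by (subst nn_integral_measure_pmf[of q]) (simp add: nn_integral_cmult)
  \<comment> \<open>The masses are added on both sides because subtraction truncates in
    [0, \<infinity>]; each sums to 1, which is finite and cancels.\<close>
  finally have "(\<integral>\<^sup>+k. K k \<partial>\<kappa> i) + 1
      = (\<integral>\<^sup>+j. (\<integral>\<^sup>+k. ennreal (pmf q j) * m k j \<partial>\<kappa> i) + ennreal (pmf q j) \<partial>count_space UNIV)"
    by (simp add: nn_integral_add nn_integral_pmf measure_pmf.emeasure_space_1[simplified])
  also have "\<dots> \<le> (\<integral>\<^sup>+j. ennreal (pmf q j) * m i j + ennreal (U i j 1) \<partial>count_space UNIV)"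
    by (intro nn_integral_mono m_step)
  also have "\<dots> = K i + 1"
    by (simp add: nn_integral_add U_mass[simplified] K_def nn_integral_measure_pmf[of q])
  finally show ?thesis by (simp add: ennreal_add_left_cancel_le add.commute[of _ 1])
qed

text \<open>Superharmonicity iterates to all powers of \<open>\<kappa>\<close>, whose weights tend
  to those of \<open>q\<close>; Fatou in the weights keeps the inequality.\<close>

lemma K_ge_mean: "(\<integral>\<^sup>+k. K k \<partial>q) \<le> K i"
proof -
  have *: "(\<integral>\<^sup>+k. K k \<partial>kpow \<kappa> n i) \<le> K i" for n i
  proof (induction n arbitrary: i)
    case (Suc n)
    then have "(\<integral>\<^sup>+k. K k \<partial>kpow \<kappa> (Suc n) i) \<le> (\<integral>\<^sup>+k. K k \<partial>\<kappa> i)"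
      by (simp add: nn_integral_mono)
    then show ?case using K_superharmonic order_trans by blast
  qed (simp add: nn_integral_return)
  have lim: "(\<lambda>n. ennreal (pmf (kpow \<kappa> n i) k) * K k) \<longlonglongrightarrow> ennreal (pmf q k) * K k" for k
    using pos[of k] kpow_lim by (intro tendsto_mult_ennreal tendsto_ennrealI tendsto_const) auto
  have "(\<integral>\<^sup>+k. K k \<partial>q)
      = (\<integral>\<^sup>+k. liminf (\<lambda>n. ennreal (pmf (kpow \<kappa> n i) k) * K k) \<partial>count_space UNIV)"
    by (simp add: nn_integral_measure_pmf[of q] lim_imp_Liminf[OF trivial_limit_sequentially lim])
  also have "\<dots> \<le> liminf (\<lambda>n. \<integral>\<^sup>+k. K k \<partial>kpow \<kappa> n i)"
    unfolding nn_integral_measure_pmf by (intro nn_integral_liminf) auto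
  also have "\<dots> \<le> liminf (\<lambda>n. K i)" by (intro Liminf_mono always_eventually allI *)
  finally show ?thesis by (simp add: Liminf_const)
qed

text \<open>A function bounded below by its own finite mean equals it almost everywhere, and
  \<open>q\<close> charges every state. If the mean is \<infinity>, the lower bound alone
  decides.\<close>

lemma K_const: "K i = (\<integral>\<^sup>+k. K k \<partial>q)"
proof (rule antisym[OF _ K_ge_mean])
  let ?c = "\<integral>\<^sup>+k. K k \<partial>q"
  show "K i \<le> ?c"
  proof (cases "?c = \<infinity>")
    case False
    have "?c = (\<integral>\<^sup>+k. (K k - ?c) + ?c \<partial>q)"
      using K_ge_mean by (intro nn_integral_cong) (simp add: diff_add_cancel_ennreal)
    also have "\<dots> = (\<integral>\<^sup>+k. K k - ?c \<partial>q) + ?c" by (simp add: nn_integral_add)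
    finally have "(\<integral>\<^sup>+k. K k - ?c \<partial>q) = 0"
      using False by (metis add.commute add.right_neutral ennreal_add_left_cancel infinity_ennreal_def)
    then have "AE k in q. K k - ?c = 0" by (subst (asm) nn_integral_0_iff_AE) auto
    then have "K i - ?c = 0" using pos[of i] by (auto simp: AE_measure_pmf_iff set_pmf_iff)
    then show ?thesis using False by (simp add: diff_eq_0_iff_ennreal)
  qed simp
qed

lemma K_eq_sum_d: "K i = (\<integral>\<^sup>+j. d j \<partial>count_space UNIV)"
proof -
  have "K i = (\<integral>\<^sup>+j. \<integral>\<^sup>+k. m k j \<partial>q \<partial>q)"
    unfolding K_const[of i] unfolding K_def by (rule nn_integral_pmf_swap) simp
  also have "\<dots> = (\<integral>\<^sup>+j. d j \<partial>count_space UNIV)"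
    unfolding d_def by (rule nn_integral_measure_pmf)
  finally show ?thesis .
qed

theorem kemeny_formula:
  defines "Dex \<equiv> \<forall>i j. convergent (\<lambda>N. U i j N - real N * pmf q j)"
    and "D \<equiv> \<lambda>i j. lim (\<lambda>N. U i j N - real N * pmf q j)"
  shows "finite (UNIV :: 's set) \<Longrightarrow> Dex \<and> enn2ereal (K i) = ereal (\<Sum>j\<in>UNIV. D j j)"
    and "Dex \<Longrightarrow> (\<lambda>j. D j j) summable_on UNIV \<Longrightarrow> enn2ereal (K i) = ereal (\<Sum>\<^sub>\<infinity>j. D j j)"
    and "Dex \<Longrightarrow> \<not> (\<lambda>j. D j j) summable_on UNIV \<Longrightarrow> K i = \<infinity>"
    and "\<not> Dex \<Longrightarrow> K i = \<infinity>"
proof -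
  \<comment> \<open>\<open>d j\<close> is one term of the sum that equals \<open>K i\<close>, and
    \<open>pmf q j * m i j\<close> is finite by \<open>m_finite\<close>; subtracting the two limits
    gives \<open>D i j = D j j - pmf q j * m i j\<close>. The contrapositive settles the case of a
    nonexistent \<open>D\<close>.\<close>
  have ex: Dex if fin: "K i < \<infinity>"
  proof -
    have d: "d j < \<infinity>" for j
    proof -
      have "d j = (\<integral>\<^sup>+x. d x * indicator {j} x \<partial>count_space UNIV)"
        by (subst nn_integral_count_space_indicator[symmetric]) (auto simp: nn_integral_count_space_finite)
      also have "\<dots> \<le> (\<integral>\<^sup>+x. d x \<partial>count_space UNIV)"
        by (intro nn_integral_mono) (auto split: split_indicator)
      also have "\<dots> < \<infinity>" using fin K_eq_sum_d[of i] by simp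
      finally show ?thesis .
    qed
    show Dex
      unfolding Dex_def
    proof (intro allI)
      fix i j
      have "ennreal (pmf q j) * m i j < \<infinity>" using m_finite by (simp add: ennreal_mult_less_top)
      then obtain x where "0 \<le> x" "ennreal (pmf q j) * m i j = ennreal x" by (auto simp: less_top_ennreal)
      then have x: "(\<lambda>N. U j j N - U i j N) \<longlonglongrightarrow> x"
        using m_lim[of j i] U_le_diag by (auto intro!: tendsto_ennrealD)
      obtain y where "0 \<le> y" "d j = ennreal y" using d[of j] by (auto simp: less_top_ennreal)
      then have y: "(\<lambda>N. U j j N - real N * pmf q j) \<longlonglongrightarrow> y"
        using d_lim[of j] U_stat_le by (auto intro!: tendsto_ennrealD)
      have "(\<lambda>N. U i j N - real N * pmf q j) \<longlonglongrightarrow> y - x"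
        using tendsto_diff[OF y x] by simp
      then show "convergent (\<lambda>N. U i j N - real N * pmf q j)" by (rule convergentI)
    qed
  qed
  then show "\<not> Dex \<Longrightarrow> K i = \<infinity>" by (metis infinity_ennreal_def less_top)
  have D: "d j = ennreal (D j j)" "0 \<le> D j j" if Dex for j
  proof -
    have l: "(\<lambda>N. U j j N - real N * pmf q j) \<longlonglongrightarrow> D j j"
      using that unfolding Dex_def D_def convergent_LIMSEQ_iff by blast
    show "0 \<le> D j j" using U_stat_le by (intro LIMSEQ_le_const[OF l]) auto
    show "d j = ennreal (D j j)"
      using LIMSEQ_unique[OF d_lim tendsto_ennrealI[OF l]] .
  qed
  have K: "K i = (\<integral>\<^sup>+j. ennreal (D j j) \<partial>count_space UNIV)" if Dex
    unfolding K_eq_sum_d[of i] by (rule nn_integral_cong) (rule D[OF that])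
  show sum: "enn2ereal (K i) = ereal (\<Sum>\<^sub>\<infinity>j. D j j)" if Dex "(\<lambda>j. D j j) summable_on UNIV"
    using K ennreal_sum_summable_iff(2)[of "\<lambda>j. D j j"] D that by (simp add: infsum_nonneg)
  show "K i = \<infinity>" if Dex "\<not> (\<lambda>j. D j j) summable_on UNIV"
    using K ennreal_sum_summable_iff(1)[of "\<lambda>j. D j j"] D that by (simp add: not_less top_unique)
  assume fin: "finite (UNIV :: 's set)"
  \<comment> \<open>With finitely many states \<open>K i\<close> is a finite sum of finite terms, so
    \<open>ex\<close> yields the existence of \<open>D\<close>.\<close>
  have "K i < \<infinity>"
    unfolding K_def nn_integral_measure_pmf using fin m_finite
    by (simp add: nn_integral_count_space_finite ennreal_mult_less_top)
  then show "Dex \<and> enn2ereal (K i) = ereal (\<Sum>j\<in>UNIV. D j j)"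
    using ex sum fin by simp
qed

end

section \<open>Discrete time\<close>

lemma emeasure_split_countable:
  fixes f :: "'w \<Rightarrow> 's::countable"
  assumes [measurable]: "f \<in> M \<rightarrow>\<^sub>M count_space UNIV" "Measurable.pred M Q"
  shows "emeasure M {\<omega>\<in>space M. Q \<omega>} = (\<integral>\<^sup>+k. emeasure M {\<omega>\<in>space M. Q \<omega> \<and> f \<omega> = k} \<partial>count_space UNIV)"
proof -
  have "{\<omega>\<in>space M. Q \<omega>} = (\<Union>k. {\<omega>\<in>space M. Q \<omega> \<and> f \<omega> = k})" by auto
  also have "emeasure M \<dots> = (\<integral>\<^sup>+k. emeasure M {\<omega>\<in>space M. Q \<omega> \<and> f \<omega> = k} \<partial>count_space UNIV)"
    by (rule emeasure_UN_countable) (auto simp: disjoint_family_on_def)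
  finally show ?thesis .
qed

text \<open>\<open>S N\<close> and \<open>V N\<close> stand for the expected occupation times of
  \<open>j\<close> up to \<open>N\<close> from \<open>j\<close> and from \<open>i\<close>, and
  \<open>R N\<close> for the one expected after the hitting time \<open>\<theta>\<close>, given its
  value. Then \<open>S N - R N\<close> is the occupation lost in the window of length
  \<open>\<theta>\<close>, and \<open>c\<close> is the stationary mass of \<open>j\<close>.\<close>

lemma hitting_limit:
  fixes R :: "nat \<Rightarrow> 'w \<Rightarrow> real" and \<theta> :: "'w \<Rightarrow> ennreal"
  assumes "prob_space M"
    and [measurable]: "\<And>N. R N \<in> borel_measurable M" "\<theta> \<in> borel_measurable M"
    and R: "\<And>N \<omega>. 0 \<le> R N \<omega>" "\<And>N \<omega>. R N \<omega> \<le> S N"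
    and V: "\<And>N. (\<integral>\<^sup>+\<omega>. ennreal (R N \<omega>) \<partial>M) = ennreal (V N)" "\<And>N. 0 \<le> V N"
    and le: "\<And>N. AE \<omega> in M. ennreal (S N - R N \<omega>) \<le> \<theta> \<omega>"
    and lim: "AE \<omega> in M. (\<lambda>N. ennreal (S N - R N \<omega>)) \<longlonglongrightarrow> ennreal c * \<theta> \<omega>"
    and c: "0 < c"
  shows "V N \<le> S N" "ennreal (S N - V N) \<le> (\<integral>\<^sup>+\<omega>. \<theta> \<omega> \<partial>M)"
    and "(\<lambda>N. ennreal (S N - V N)) \<longlonglongrightarrow> ennreal c * (\<integral>\<^sup>+\<omega>. \<theta> \<omega> \<partial>M)"
proof -
  interpret prob_space M by fact
  have S: "0 \<le> S N" for N using R order_trans by blast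
  show VS: "V N \<le> S N" for N
  proof -
    have "ennreal (V N) \<le> (\<integral>\<^sup>+\<omega>. ennreal (S N) \<partial>M)"
      unfolding V(1)[symmetric] by (intro nn_integral_mono) (simp add: R ennreal_leI)
    then show ?thesis using S by (simp add: emeasure_space_1)
  qed
  have diff: "(\<integral>\<^sup>+\<omega>. ennreal (S N - R N \<omega>) \<partial>M) = ennreal (S N - V N)" for N
  proof -
    have "(\<integral>\<^sup>+\<omega>. ennreal (S N - R N \<omega>) \<partial>M) = (\<integral>\<^sup>+\<omega>. ennreal (S N) - ennreal (R N \<omega>) \<partial>M)"
      by (simp add: R ennreal_minus)
    also have "\<dots> = (\<integral>\<^sup>+\<omega>. ennreal (S N) \<partial>M) - (\<integral>\<^sup>+\<omega>. ennreal (R N \<omega>) \<partial>M)"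
      by (intro nn_integral_diff) (auto simp: V R ennreal_leI)
    finally show ?thesis by (simp add: V emeasure_space_1 ennreal_minus)
  qed
  show "ennreal (S N - V N) \<le> (\<integral>\<^sup>+\<omega>. \<theta> \<omega> \<partial>M)"
    unfolding diff[symmetric] using le by (intro nn_integral_mono_AE) auto
  show "(\<lambda>N. ennreal (S N - V N)) \<longlonglongrightarrow> ennreal c * (\<integral>\<^sup>+\<omega>. \<theta> \<omega> \<partial>M)"
    unfolding diff[symmetric] using le lim c by (intro nn_integral_tendsto_cmult) auto
qed

text \<open>Serves the paths that never reach \<open>j\<close>: the loss is then the whole expected
  occupation time from \<open>j\<close>, which has to diverge in order to match
  \<open>c * \<infinity>\<close>.\<close>

lemma increments_imp_tendsto_top:
  fixes S :: "nat \<Rightarrow> real"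
  assumes "(\<lambda>N. S (Suc N) - S N) \<longlonglongrightarrow> c" "0 < c"
  shows "(\<lambda>N. ennreal (S N)) \<longlonglongrightarrow> \<infinity>"
proof -
  have "\<forall>\<^sub>F N in sequentially. c / 2 < S (Suc N) - S N"
    using assms by (intro order_tendstoD(1)[OF assms(1)]) simp
  then obtain N0 where N0: "\<And>N. N \<ge> N0 \<Longrightarrow> c / 2 < S (Suc N) - S N"
    by (auto simp: eventually_sequentially)
  have "S N0 + real n * (c / 2) \<le> S (n + N0)" for n
  proof (induction n)
    case (Suc n)
    then show ?case using N0[of "n + N0"] by (simp add: algebra_simps add_divide_distrib)
  qed simp
  then have ge: "\<forall>\<^sub>F n in sequentially. S N0 + real n * (c / 2) \<le> S (n + N0)" by (intro always_eventually allI)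
  have "LIM n sequentially. S N0 + real n * (c / 2) :> at_top"
    using assms(2)
    by (intro filterlim_tendsto_add_at_top[OF tendsto_const]
        filterlim_at_top_mult_tendsto_pos[OF tendsto_const _ filterlim_real_sequentially]) auto
  from filterlim_at_top_mono[OF this ge] have "LIM n sequentially. S (n + N0) :> at_top" .
  then have seg: "\<forall>\<^sub>F n in sequentially. Z \<le> S (n + N0)" for Z
    unfolding filterlim_at_top by blast
  have "LIM N sequentially. S N :> at_top"
    unfolding filterlim_at_top
    using eventually_sequentially_seg[of "\<lambda>n. Z \<le> S n" N0 for Z] seg by blast
  then show ?thesis by (simp add: ennreal_tendsto_top_eq_at_top)
qed

section \<open>The Markov property and first passage in discrete time\<close>

locale dt_chain =
  fixes \<kappa> :: "'s::countable \<Rightarrow> 's pmf" and M :: "'s \<Rightarrow> 'w measure" and X :: "nat \<Rightarrow> 'w \<Rightarrow> 's"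
  assumes chain: "dt_markov_chain (\<lambda>i. pmf (\<kappa> i)) M X"
begin

lemma prob_space_M: "prob_space (M i)"
  using chain by (simp add: dt_markov_chain_def)

lemma measurable_X [measurable]: "X n \<in> M i \<rightarrow>\<^sub>M count_space UNIV"
  using chain by (simp add: dt_markov_chain_def)

lemma X_0: "AE \<omega> in M i. X 0 \<omega> = i"
  using chain by (simp add: dt_markov_chain_def)

text \<open>The history packed into one random variable with countably many values, so that any
  event of the past splits into countably many cylinders.\<close>

definition path :: "nat \<Rightarrow> 'w \<Rightarrow> 's list" where "path n \<omega> = map (\<lambda>k. X k \<omega>) [0..<Suc n]"

lemma nth_path: "k \<le> n \<Longrightarrow> path n \<omega> ! k = X k \<omega>"
  by (simp add: path_def del: upt_Suc)

lemma path_eq_iff: "path n \<omega> = xs \<longleftrightarrow> length xs = Suc n \<and> (\<forall>k\<le>n. X k \<omega> = xs ! k)"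
  by (auto simp: path_def list_eq_iff_nth_eq less_Suc_eq_le simp del: upt_Suc)

lemma measurable_path [measurable]: "path n \<in> M i \<rightarrow>\<^sub>M count_space UNIV"
proof (subst measurable_count_space_eq2_countable)
  have [measurable]: "Measurable.pred (M i) (\<lambda>\<omega>. path n \<omega> = xs)" for xs
    unfolding path_eq_iff by measurable
  show "path n \<in> space (M i) \<rightarrow> UNIV \<and> (\<forall>xs\<in>UNIV. path n -` {xs} \<inter> space (M i) \<in> sets (M i))"
    by (auto simp: vimage_def Int_def conj_commute)
qed

text \<open>Product form of the conditional hypothesis; for a history of probability 0 both sides
  vanish.\<close>

lemma markov_cylinder:
  assumes len: "length xs = Suc n"
  shows "emeasure (M i) {\<omega>\<in>space (M i). path n \<omega> = xs \<and> X (Suc n) \<omega> = j}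
    = emeasure (M i) {\<omega>\<in>space (M i). path n \<omega> = xs} * ennreal (pmf (\<kappa> (xs ! n)) j)"
proof -
  interpret prob_space "M i" by (rule prob_space_M)
  let ?A = "{\<omega>\<in>space (M i). path n \<omega> = xs}"
  let ?B = "{\<omega>\<in>space (M i). path n \<omega> = xs \<and> X (Suc n) \<omega> = j}"
  have "prob ?B = prob ?A * pmf (\<kappa> (xs ! n)) j"
  proof (cases "prob ?A = 0")
    case True
    moreover have "prob ?B \<le> prob ?A" by (intro finite_measure_mono) auto
    ultimately show ?thesis by (simp add: measure_le_0_iff)
  next
    case False
    then have "prob ?A > 0" by (simp add: zero_less_measure_iff)
    then have "\<P>(\<omega> in M i. X (Suc n) \<omega> = j \<bar> \<forall>k\<le>n. X k \<omega> = xs ! k) = pmf (\<kappa> (xs ! n)) j"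
      using chain len unfolding dt_markov_chain_def path_eq_iff by simp
    then show ?thesis
      using False len by (simp add: cond_prob_def path_eq_iff field_simps conj_commute)
  qed
  then show ?thesis by (simp add: emeasure_eq_measure ennreal_mult)
qed

text \<open>Cylinders summed over all histories that satisfy \<open>A\<close> and end in
  \<open>s\<close>.\<close>

lemma markov_step:
  "emeasure (M i) {\<omega>\<in>space (M i). A (path n \<omega>) \<and> X n \<omega> = s \<and> X (Suc n) \<omega> = j}
    = emeasure (M i) {\<omega>\<in>space (M i). A (path n \<omega>) \<and> X n \<omega> = s} * ennreal (pmf (\<kappa> s) j)"
proof -
  have eq: "emeasure (M i) {\<omega>\<in>space (M i). (A (path n \<omega>) \<and> X n \<omega> = s \<and> X (Suc n) \<omega> = j) \<and> path n \<omega> = xs}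
    = emeasure (M i) {\<omega>\<in>space (M i). (A (path n \<omega>) \<and> X n \<omega> = s) \<and> path n \<omega> = xs} * ennreal (pmf (\<kappa> s) j)" for xs
  proof (cases "A xs \<and> length xs = Suc n \<and> xs ! n = s")
    case True
    then have 1: "(A (path n \<omega>) \<and> X n \<omega> = s \<and> X (Suc n) \<omega> = j) \<and> path n \<omega> = xs \<longleftrightarrow> path n \<omega> = xs \<and> X (Suc n) \<omega> = j"
      and 2: "(A (path n \<omega>) \<and> X n \<omega> = s) \<and> path n \<omega> = xs \<longleftrightarrow> path n \<omega> = xs" for \<omega>
      using nth_path[of n n] by auto
    show ?thesis unfolding 1 2 using True markov_cylinder by auto
  next
    case False
    then have "\<not> (A (path n \<omega>) \<and> X n \<omega> = s \<and> path n \<omega> = xs)" for \<omega>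
      using nth_path[of n n \<omega>] path_eq_iff[of n \<omega> xs] by auto
    then have "{\<omega>\<in>space (M i). (A (path n \<omega>) \<and> X n \<omega> = s \<and> X (Suc n) \<omega> = j) \<and> path n \<omega> = xs} = {}"
      "{\<omega>\<in>space (M i). (A (path n \<omega>) \<and> X n \<omega> = s) \<and> path n \<omega> = xs} = {}" by auto
    then show ?thesis by (simp only: emeasure_empty) simp
  qed
  show ?thesis
    by (subst (1 2) emeasure_split_countable[where f="path n"])
       (simp_all add: eq nn_integral_multc del: conj_assoc)
qed

lemma markov:
  "emeasure (M i) {\<omega>\<in>space (M i). A (path n \<omega>) \<and> X n \<omega> = s \<and> X (n + l) \<omega> = j}
    = emeasure (M i) {\<omega>\<in>space (M i). A (path n \<omega>) \<and> X n \<omega> = s} * ennreal (pmf (kpow \<kappa> l s) j)"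
    (is "_ = ?c * _")
proof (induction l arbitrary: j)
  case 0
  show ?case
  proof (cases "s = j")
    case True
    then show ?thesis by simp
  next
    case False
    then have "{\<omega>\<in>space (M i). A (path n \<omega>) \<and> X n \<omega> = s \<and> X (n + 0) \<omega> = j} = {}" by auto
    with False show ?thesis by (simp only: emeasure_empty) simp
  qed
next
  case (Suc l)
  \<comment> \<open>An event of the first \<open>n\<close> steps has to be expressed through the
    longer history \<open>path (n + l)\<close> before \<open>markov_step\<close> applies at time
    \<open>n + l\<close>.\<close>
  have take: "take (Suc n) (path (n + l) \<omega>) = path n \<omega>" "path (n + l) \<omega> ! n = X n \<omega>" for \<omega>
    by (simp_all add: path_def take_map take_upt nth_path[unfolded path_def] del: upt_Suc)
  have "emeasure (M i) {\<omega>\<in>space (M i). A (path n \<omega>) \<and> X n \<omega> = s \<and> X (n + Suc l) \<omega> = j}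
    = (\<integral>\<^sup>+k. emeasure (M i) {\<omega>\<in>space (M i). (A (path n \<omega>) \<and> X n \<omega> = s \<and> X (n + Suc l) \<omega> = j) \<and> X (n + l) \<omega> = k} \<partial>count_space UNIV)"
    by (intro emeasure_split_countable) measurable
  also have "\<dots> = (\<integral>\<^sup>+k. emeasure (M i) {\<omega>\<in>space (M i). A (path n \<omega>) \<and> X n \<omega> = s \<and> X (n + l) \<omega> = k} * ennreal (pmf (\<kappa> k) j) \<partial>count_space UNIV)"
    using markov_step[of i "\<lambda>xs. A (take (Suc n) xs) \<and> xs ! n = s" "n + l" _ j]
    by (simp add: take conj_ac)
  also have "\<dots> = (\<integral>\<^sup>+k. ?c * (ennreal (pmf (kpow \<kappa> l s) k) * ennreal (pmf (\<kappa> k) j)) \<partial>count_space UNIV)"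
    by (simp add: Suc mult.assoc)
  also have "\<dots> = ?c * (\<integral>\<^sup>+k. ennreal (pmf (\<kappa> k) j) \<partial>kpow \<kappa> l s)"
    by (simp add: nn_integral_cmult nn_integral_measure_pmf)
  also have "\<dots> = ?c * ennreal (pmf (kpow \<kappa> (Suc l) s) j)"
    using kpow_add[of \<kappa> l 1 s] kpow_1[of \<kappa>] by (simp add: ennreal_pmf_bind del: kpow.simps)
  finally show ?case .
qed

lemma emeasure_X: "emeasure (M i) {\<omega>\<in>space (M i). X n \<omega> = j} = ennreal (pmf (kpow \<kappa> n i) j)"
proof -
  interpret prob_space "M i" by (rule prob_space_M)
  have "emeasure (M i) {\<omega>\<in>space (M i). X n \<omega> = j} = emeasure (M i) {\<omega>\<in>space (M i). True \<and> X 0 \<omega> = i \<and> X (0 + n) \<omega> = j}"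
  proof (rule emeasure_eq_AE)
    show "AE \<omega> in M i. \<omega> \<in> {\<omega>\<in>space (M i). X n \<omega> = j}
        \<longleftrightarrow> \<omega> \<in> {\<omega>\<in>space (M i). True \<and> X 0 \<omega> = i \<and> X (0 + n) \<omega> = j}"
      using X_0[of i] by eventually_elim auto
  qed measurable
  also have "\<dots> = emeasure (M i) {\<omega>\<in>space (M i). True \<and> X 0 \<omega> = i} * ennreal (pmf (kpow \<kappa> n i) j)"
    by (rule markov)
  also have "emeasure (M i) {\<omega>\<in>space (M i). True \<and> X 0 \<omega> = i} = 1"
    using X_0[of i] by (intro emeasure_eq_1_AE) auto
  finally show ?thesis by simp
qed

definition hit :: "'s \<Rightarrow> nat \<Rightarrow> 'w \<Rightarrow> bool" where
  "hit j m \<omega> \<longleftrightarrow> X m \<omega> = j \<and> (\<forall>k<m. X k \<omega> \<noteq> j)"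

lemma measurable_hit [measurable]: "Measurable.pred (M i) (hit j m)"
  unfolding hit_def[abs_def] by measurable

lemma hit_Least: "hit j m \<omega> \<Longrightarrow> (LEAST m. X m \<omega> = j) = m"
  by (rule Least_equality) (auto simp: hit_def not_less[symmetric])

lemma hit_unique: "hit j m \<omega> \<Longrightarrow> hit j m' \<omega> \<Longrightarrow> m = m'"
  using hit_Least by blast

lemma ex_hit: "X n \<omega> = j \<Longrightarrow> \<exists>m\<le>n. hit j m \<omega>"
  by (induction n rule: less_induct) (metis hit_def less_imp_le order_trans order_refl)

text \<open>The least index is unspecified when \<open>j\<close> is never hit; a finite sum over the
  possible first hits replaces it, which gives measurability and termwise integration.\<close>

lemma hit_sum:
  fixes g :: "nat \<Rightarrow> ennreal"
  assumes \<omega>: "\<omega> \<in> space (M i)"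
  shows "(\<Sum>m\<le>n. g m * indicator {\<omega>\<in>space (M i). hit j m \<omega>} \<omega>)
    = (if \<exists>m\<le>n. X m \<omega> = j then g (LEAST m. X m \<omega> = j) else 0)"
proof (cases "\<exists>m\<le>n. X m \<omega> = j")
  case True
  then obtain m where m: "m \<le> n" "hit j m \<omega>" using ex_hit order_trans by blast
  have "(\<Sum>m\<le>n. g m * indicator {\<omega>\<in>space (M i). hit j m \<omega>} \<omega>)
      = (\<Sum>m'\<le>n. if m' = m then g m' else 0)"
    using m \<omega> by (intro sum.cong) (auto dest: hit_unique split: split_indicator)
  then show ?thesis using m True by (simp add: hit_Least)
next
  case False
  then show ?thesis by (auto simp: hit_def intro!: sum.neutral split: split_indicator)
qed

lemma measurable_first_passage:
  fixes g :: "nat \<Rightarrow> ennreal"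
  shows "(\<lambda>\<omega>. if \<exists>m\<le>n. X m \<omega> = j then g (LEAST m. X m \<omega> = j) else 0) \<in> borel_measurable (M i)"
  by (subst measurable_cong[OF hit_sum[symmetric]]) measurable

text \<open>The first hits at \<open>m \<le> n\<close> partition the event \<open>X n = j\<close>,
  and the Markov property at \<open>m\<close> gives the factor for the remaining
  \<open>n - m\<close> steps. The form of a mean over the hitting time is the one that survives
  refinement of a time grid.\<close>

lemma first_passage:
  "(\<integral>\<^sup>+\<omega>. (if \<exists>m\<le>n. X m \<omega> = j then ennreal (pmf (kpow \<kappa> (n - (LEAST m. X m \<omega> = j)) j) j) else 0) \<partial>M i)
    = ennreal (pmf (kpow \<kappa> n i) j)"
proof -
  let ?u = "\<lambda>n. ennreal (pmf (kpow \<kappa> n j) j)"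
  have "(\<integral>\<^sup>+\<omega>. (if \<exists>m\<le>n. X m \<omega> = j then ?u (n - (LEAST m. X m \<omega> = j)) else 0) \<partial>M i)
      = (\<integral>\<^sup>+\<omega>. (\<Sum>m\<le>n. ?u (n - m) * indicator {\<omega>\<in>space (M i). hit j m \<omega>} \<omega>) \<partial>M i)"
    by (intro nn_integral_cong hit_sum[symmetric])
  also have "\<dots> = (\<Sum>m\<le>n. ?u (n - m) * emeasure (M i) {\<omega>\<in>space (M i). hit j m \<omega>})"
    by (subst nn_integral_sum) (auto intro!: sum.cong nn_integral_cmult_indicator)
  also have "\<dots> = (\<Sum>m\<le>n. emeasure (M i) {\<omega>\<in>space (M i). hit j m \<omega> \<and> X n \<omega> = j})"
  proof (intro sum.cong refl)
    fix m assume "m \<in> {..n}"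
    then have n: "n = m + (n - m)" by simp
    have "hit j m \<omega> \<longleftrightarrow> (\<forall>k<m. path m \<omega> ! k \<noteq> j) \<and> X m \<omega> = j" for \<omega>
      by (auto simp: hit_def nth_path)
    then show "?u (n - m) * emeasure (M i) {\<omega>\<in>space (M i). hit j m \<omega>}
        = emeasure (M i) {\<omega>\<in>space (M i). hit j m \<omega> \<and> X n \<omega> = j}"
      using markov[of i "\<lambda>xs. \<forall>k<m. xs ! k \<noteq> j" m j "n - m" j] n by (simp add: mult.commute conj_assoc)
  qed
  also have "\<dots> = emeasure (M i) (\<Union>m\<in>{..n}. {\<omega>\<in>space (M i). hit j m \<omega> \<and> X n \<omega> = j})"
    by (intro sum_emeasure) (auto dest: hit_unique simp: disjoint_family_on_def image_subset_iff)
  also have "(\<Union>m\<in>{..n}. {\<omega>\<in>space (M i). hit j m \<omega> \<and> X n \<omega> = j}) = {\<omega>\<in>space (M i). X n \<omega> = j}"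
    using ex_hit by blast
  finally show ?thesis by (simp add: emeasure_X)
qed

end

section \<open>Occupation times in discrete time\<close>

lemma irreducible_stationary_pos:
  assumes st: "bind_pmf q \<kappa> = q" and irr: "\<And>i j. \<exists>n. 0 < pmf (kpow \<kappa> n i) j"
  shows "0 < pmf q j"
proof -
  \<comment> \<open>Some \<open>i\<close> carries mass, \<open>j\<close> is reachable from it, and
    stationarity carries the mass over.\<close>
  obtain i where i: "i \<in> set_pmf q" using set_pmf_not_empty[of q] by blast
  obtain n where "0 < pmf (kpow \<kappa> n i) j" using irr by blast
  then have "j \<in> set_pmf (kpow \<kappa> n i)" by (simp add: set_pmf_iff)
  then have "j \<in> set_pmf (bind_pmf q (kpow \<kappa> n))" using i by auto
  then show ?thesis by (simp add: kpow_stationary[OF st] pmf_positive)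
qed

text \<open>The difference is a window of \<open>L\<close> final terms, each with limit
  \<open>c\<close>.\<close>

lemma window_sum_tendsto:
  fixes u :: "nat \<Rightarrow> real"
  assumes "u \<longlonglongrightarrow> c"
  shows "(\<lambda>N. (\<Sum>n<N. u n) - (\<Sum>n<N - L. u n)) \<longlonglongrightarrow> real L * c"
proof (induction L)
  case (Suc L)
  have "filterlim (\<lambda>N. N - Suc L) sequentially sequentially"
    by (rule filterlim_minus_const_nat_at_top)
  then have "(\<lambda>N. u (N - Suc L)) \<longlonglongrightarrow> c" by (rule filterlim_compose[OF assms])
  from tendsto_add[OF Suc this]
  have "(\<lambda>N. (\<Sum>n<N. u n) - (\<Sum>n<N - L. u n) + u (N - Suc L)) \<longlonglongrightarrow> real (Suc L) * c"
    by (simp add: algebra_simps)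
  \<comment> \<open>From \<open>N = Suc L\<close> on the subtraction is not truncated, and widening
    the window removes exactly one term from the second sum.\<close>
  moreover have "\<forall>\<^sub>F N in sequentially. (\<Sum>n<N. u n) - (\<Sum>n<N - L. u n) + u (N - Suc L)
      = (\<Sum>n<N. u n) - (\<Sum>n<N - Suc L. u n)"
    using eventually_ge_at_top[of "Suc L"]
  proof eventually_elim
    case (elim N)
    then have "N - L = Suc (N - Suc L)" by simp
    then show ?case by simp
  qed
  ultimately show ?case by (rule Lim_transform_eventually)
qed simp

lemma window_sum_le:
  fixes u :: "nat \<Rightarrow> real"
  assumes "\<And>n. u n \<le> 1"
  shows "(\<Sum>n<N. u n) - (\<Sum>n<N - L. u n) \<le> real L"
proof -
  have "(\<Sum>n<N. u n) - (\<Sum>n<N - L. u n) = (\<Sum>n\<in>{N - L..<N}. u n)"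
    using sum_diff_nat_ivl[of 0 "N - L" N u] by (simp add: atLeast0LessThan)
  also have "\<dots> \<le> (\<Sum>n\<in>{N - L..<N}. 1)" by (intro sum_mono assms)
  finally show ?thesis by simp
qed

lemma dt_hitting_time_eq:
  "dt_hitting_time X j \<omega> = (if \<exists>n. X n \<omega> = j then of_nat (LEAST n. X n \<omega> = j) else \<infinity>)"
proof (cases "\<exists>n. X n \<omega> = j")
  case True
  have "dt_hitting_time X j \<omega> = of_nat (LEAST n. X n \<omega> = j)"
    unfolding dt_hitting_time_def
  proof (rule antisym)
    show "(INF n\<in>{n. X n \<omega> = j}. of_nat n :: ennreal) \<le> of_nat (LEAST n. X n \<omega> = j)"
      using LeastI_ex[OF True] by (intro INF_lower) simp
    show "of_nat (LEAST n. X n \<omega> = j) \<le> (INF n\<in>{n. X n \<omega> = j}. of_nat n :: ennreal)"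
      by (intro INF_greatest) (auto intro: Least_le)
  qed
  with True show ?thesis by simp
qed (auto simp: dt_hitting_time_def)

context dt_chain
begin

lemma measurable_hitting_time [measurable]: "dt_hitting_time X j \<in> borel_measurable (M i)"
proof -
  have "dt_hitting_time X j \<omega> = (INF n. if X n \<omega> = j then of_nat n else \<infinity>)" for \<omega>
    unfolding dt_hitting_time_def
  proof (rule antisym)
    show "(INF n\<in>{n. X n \<omega> = j}. of_nat n) \<le> (INF n. if X n \<omega> = j then of_nat n else \<infinity> :: ennreal)"
      by (rule INF_greatest) (auto intro: INF_lower)
    show "(INF n. if X n \<omega> = j then of_nat n else \<infinity> :: ennreal) \<le> (INF n\<in>{n. X n \<omega> = j}. of_nat n)"
    proof (rule INF_greatest)
      fix n assume "n \<in> {n. X n \<omega> = j}"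
      then show "(INF n. if X n \<omega> = j then of_nat n else \<infinity> :: ennreal) \<le> of_nat n"
        by (intro INF_lower2[of n]) auto
    qed
  qed
  then have "dt_hitting_time X j = (\<lambda>\<omega>. INF n. if X n \<omega> = j then of_nat n else \<infinity>)" by blast
  moreover have "(\<lambda>\<omega>. INF n. if X n \<omega> = j then of_nat n else \<infinity> :: ennreal) \<in> borel_measurable (M i)"
    by measurable
  ultimately show ?thesis by simp
qed

text \<open>Times 0 to \<open>N - 1\<close> are counted, so \<open>occ i j 1\<close> is the
  indicator of \<open>i = j\<close> and has total mass 1 over \<open>j\<close>, as
  \<open>U_mass\<close> demands.\<close>

definition occ :: "'s \<Rightarrow> 's \<Rightarrow> nat \<Rightarrow> real" where
  "occ i j N = (\<Sum>n<N. pmf (kpow \<kappa> n i) j)"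

text \<open>The expected occupation of \<open>j\<close> before \<open>N\<close>, counted from the
  hitting time and given its value. Truncated subtraction makes it 0 when the hit comes after
  \<open>N\<close>.\<close>

definition rest :: "'s \<Rightarrow> nat \<Rightarrow> 'w \<Rightarrow> real" where
  "rest j N \<omega> = (if \<exists>m. X m \<omega> = j then occ j j (N - (LEAST m. X m \<omega> = j)) else 0)"

lemma occ_nonneg: "0 \<le> occ i j N"
  by (simp add: occ_def sum_nonneg)

text \<open>Each summand is the integrand of \<open>first_passage\<close> at time \<open>n\<close>,
  so the mean of \<open>rest\<close> follows term by term.\<close>

lemma rest_eq:
  "ennreal (rest j N \<omega>)
    = (\<Sum>n<N. if \<exists>m\<le>n. X m \<omega> = j then ennreal (pmf (kpow \<kappa> (n - (LEAST m. X m \<omega> = j)) j) j) else 0)"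
proof (cases "\<exists>m. X m \<omega> = j")
  case True
  define L where "L = (LEAST m. X m \<omega> = j)"
  have "X L \<omega> = j" and le: "\<And>m. X m \<omega> = j \<Longrightarrow> L \<le> m"
    using LeastI_ex[OF True] Least_le[of "\<lambda>m. X m \<omega> = j"] by (auto simp: L_def)
  then have iff: "(\<exists>m\<le>n. X m \<omega> = j) \<longleftrightarrow> L \<le> n" for n
    using order_trans by blast
  have "(\<Sum>n<N. if L \<le> n then ennreal (pmf (kpow \<kappa> (n - L) j) j) else 0) = ennreal (occ j j (N - L))"
  proof (induction N)
    case (Suc N)
    show ?case
    proof (cases "L \<le> N")
      case True
      then have "Suc N - L = Suc (N - L)" by simp
      then show ?thesis using Suc True by (simp add: occ_def sum_nonneg)
    next
      case False
      then show ?thesis using Suc by simp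
    qed
  qed (simp add: occ_def)
  then show ?thesis using True unfolding rest_def L_def[symmetric] iff by simp
qed (auto simp: rest_def)

lemma measurable_rest [measurable]: "rest j N \<in> borel_measurable (M i)"
proof -
  have nn: "0 \<le> rest j N \<omega>" for \<omega> by (simp add: rest_def occ_nonneg)
  have "(\<lambda>\<omega>. ennreal (rest j N \<omega>)) \<in> borel_measurable (M i)"
    unfolding rest_eq by (intro borel_measurable_sum measurable_first_passage)
  then have "(\<lambda>\<omega>. enn2real (ennreal (rest j N \<omega>))) \<in> borel_measurable (M i)" by measurable
  then show ?thesis using nn by simp
qed

lemma nn_integral_rest: "(\<integral>\<^sup>+\<omega>. ennreal (rest j N \<omega>) \<partial>M i) = ennreal (occ i j N)"
  unfolding rest_eq
  by (subst nn_integral_sum) (auto simp: measurable_first_passage first_passage occ_def)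

lemma occupation_occ:
  assumes st: "bind_pmf q \<kappa> = q" and irr: "\<And>i j. \<exists>n. 0 < pmf (kpow \<kappa> n i) j"
    and aper: "\<And>i. Gcd {n. 0 < n \<and> 0 < pmf (kpow \<kappa> n i) i} = 1"
  shows "occupation \<kappa> q occ (dt_mean_hitting M X)"
proof
  show pos: "0 < pmf q j" for j by (rule irreducible_stationary_pos[OF st irr])
  show lim: "(\<lambda>n. pmf (kpow \<kappa> n i) j) \<longlonglongrightarrow> pmf q j" for i j
    by (rule pmf_kpow_tendsto_stationary[OF st pos aperiodic_meet[OF irr aper]])
  fix i j N
  show "0 \<le> occ i j N" by (rule occ_nonneg)
  show "occ i j N \<le> real N"
    using sum_mono[of "{..<N}" "\<lambda>n. pmf (kpow \<kappa> n i) j" "\<lambda>_. 1"] by (simp add: occ_def pmf_le_1)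
  show "occ i j N \<le> occ i j (Suc N)" by (simp add: occ_def)
  have int: "integrable (measure_pmf p) (\<lambda>k. pmf (kpow \<kappa> n k) j)" for p n
    by (intro integrable_pmf_bounded[where B=1]) (simp add: pmf_le_1)
  have "(\<integral>k. occ k j N \<partial>\<kappa> i) = (\<Sum>n<N. pmf (kpow \<kappa> (Suc n) i) j)"
    using int by (simp add: occ_def pmf_bind)
  also have "\<dots> = occ i j (Suc N) - occ i j 1"
    unfolding occ_def by (subst sum.lessThan_Suc_shift) simp
  finally show "(\<integral>k. occ k j N \<partial>\<kappa> i) = occ i j (Suc N) - occ i j 1" .
  show "(\<lambda>N. occ i j (Suc N) - occ i j N) \<longlonglongrightarrow> pmf q j"
    using lim by (simp add: occ_def)
  show "(\<integral>\<^sup>+j. ennreal (occ i j 1) \<partial>count_space UNIV) = 1"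
    using nn_integral_pmf[where p="return_pmf i" and A=UNIV] measure_pmf.emeasure_space_1[of "return_pmf i"]
    by (simp add: occ_def del: pmf_return)
  have "(\<integral>i. pmf (kpow \<kappa> n i) j \<partial>q) = pmf q j" for n
    using arg_cong[OF kpow_stationary[OF st, of n], of "\<lambda>p. pmf p j"] by (simp add: pmf_bind)
  then show "(\<integral>i. occ i j N \<partial>q) = real N * pmf q j"
    using int by (simp add: occ_def)
  have le: "ennreal (occ j j N - rest j N \<omega>) \<le> dt_hitting_time X j \<omega>" for N \<omega>
    using window_sum_le[of "\<lambda>n. pmf (kpow \<kappa> n j) j" N "LEAST m. X m \<omega> = j"]
    by (auto simp: dt_hitting_time_eq rest_def occ_def pmf_le_1 ennreal_leI simp flip: ennreal_of_nat_eq_real_of_nat)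
  \<comment> \<open>After a first hit at step \<open>L\<close> the difference is the sum of the last
    \<open>L\<close> terms; without a hit \<open>rest\<close> is 0 and the divergence of
    \<open>occ j j\<close> supplies \<infinity>.\<close>
  have hl: "(\<lambda>N. ennreal (occ j j N - rest j N \<omega>)) \<longlonglongrightarrow> ennreal (pmf q j) * dt_hitting_time X j \<omega>" for \<omega>
  proof (cases "\<exists>m. X m \<omega> = j")
    case True
    have "(\<lambda>N. ennreal (occ j j N - rest j N \<omega>)) \<longlonglongrightarrow> ennreal (real (LEAST m. X m \<omega> = j) * pmf q j)"
      using True tendsto_ennrealI[OF window_sum_tendsto[OF lim]] by (simp add: rest_def occ_def)
    with True show ?thesis
      by (simp add: dt_hitting_time_eq ennreal_mult mult.commute flip: ennreal_of_nat_eq_real_of_nat)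
  next
    case False
    have "(\<lambda>N. ennreal (occ j j N)) \<longlonglongrightarrow> \<infinity>"
      using lim pos by (intro increments_imp_tendsto_top) (auto simp: occ_def)
    with False show ?thesis using pos[of j] by (simp add: dt_hitting_time_eq rest_def ennreal_mult_top)
  qed
  have mono: "occ j j (N - L) \<le> occ j j N" for L N
    unfolding occ_def by (intro sum_mono2) auto
  have rest: "0 \<le> rest j N \<omega>" "rest j N \<omega> \<le> occ j j N" for N \<omega>
    using mono by (auto simp: rest_def occ_nonneg)
  note * = hitting_limit[OF prob_space_M measurable_rest measurable_hitting_time rest nn_integral_rest occ_nonneg _ _ pos[of j]]
  show "occ i j N \<le> occ j j N" by (rule *(1)) (use le hl in auto)
  show "ennreal (occ j j N - occ i j N) \<le> dt_mean_hitting M X i j"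
    unfolding dt_mean_hitting_def by (rule *(2)) (use le hl in auto)
  show "(\<lambda>N. ennreal (occ j j N - occ i j N)) \<longlonglongrightarrow> ennreal (pmf q j) * dt_mean_hitting M X i j"
    unfolding dt_mean_hitting_def by (rule *(3)) (use le hl in auto)
qed

end

theorem dt_kemeny:
  fixes \<pi> :: "'s::countable \<Rightarrow> real" and M :: "'s \<Rightarrow> 'w measure"
  assumes chain: "dt_markov_chain P M X" and irr: "dt_irreducible P" and aper: "dt_aperiodic P"
    and st: "dt_stationary P \<pi>"
  defines "K \<equiv> kemeny_sum \<pi> (dt_mean_hitting M X)" and "D \<equiv> dt_deviation P \<pi>"
  shows "K i = K i'"
    and "finite (UNIV :: 's set) \<Longrightarrow> dt_deviation_exists P \<pi> \<and> enn2ereal (K i) = ereal (\<Sum>j\<in>UNIV. D j j)"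
    and "dt_deviation_exists P \<pi> \<Longrightarrow> (\<lambda>j. D j j) summable_on UNIV \<Longrightarrow> enn2ereal (K i) = ereal (\<Sum>\<^sub>\<infinity>j. D j j)"
    and "dt_deviation_exists P \<pi> \<Longrightarrow> \<not> (\<lambda>j. D j j) summable_on UNIV \<Longrightarrow> K i = \<infinity>"
    and "\<not> dt_deviation_exists P \<pi> \<Longrightarrow> K i = \<infinity>"
proof -
  have "\<forall>i. \<exists>p. pmf p = P i"
    using chain prob_dist_pmfD by (auto simp: dt_markov_chain_def stochastic_matrix_def)
  then obtain \<kappa> where \<kappa>: "\<And>i. pmf (\<kappa> i) = P i" by metis
  obtain q where q: "pmf q = \<pi>" using st prob_dist_pmfD by (auto simp: dt_stationary_def)
  have P: "P = (\<lambda>i. pmf (\<kappa> i))" using \<kappa> by auto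
  note mp = mat_pow_eq_pmf_kpow[of \<kappa> P, OF \<kappa>]
  interpret dt_chain \<kappa> M X using chain by unfold_locales (simp add: P)
  have "bind_pmf q \<kappa> = q"
  proof (rule pmf_eqI)
    fix j
    have "((\<lambda>i. pmf q i * pmf (\<kappa> i) j) has_sum pmf (bind_pmf q \<kappa>) j) UNIV"
      unfolding pmf_bind by (intro has_sum_pmf_integral integrable_pmf_bounded[where B=1]) (simp add: pmf_le_1)
    moreover have "((\<lambda>i. pmf q i * pmf (\<kappa> i) j) has_sum pmf q j) UNIV"
      using st by (simp add: dt_stationary_def q \<kappa>)
    ultimately show "pmf (bind_pmf q \<kappa>) j = pmf q j" by (rule has_sum_unique)
  qed
  then interpret occ: occupation \<kappa> q occ "dt_mean_hitting M X"
    using irr aper by (intro occupation_occ) (auto simp: dt_irreducible_def dt_aperiodic_def mp)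
  have K: "K = occ.K"
    by (simp add: fun_eq_iff K_def kemeny_sum_def occ.K_def infsum_pmf_eq_nn_integral flip: q)
  \<comment> \<open>Partial sums of the series for \<open>D\<close> are the centred occupation times
    of \<open>kemeny_formula\<close>; since \<open>suminf\<close> is itself a \<open>lim\<close>,
    \<open>D\<close> is identified without asking for convergence.\<close>
  have sums: "(\<Sum>n<N. mat_pow P n i j - \<pi> j) = occ i j N - real N * pmf q j" for i j N
    by (simp add: mp occ_def q sum_subtractf)
  have ex: "dt_deviation_exists P \<pi> \<longleftrightarrow> (\<forall>i j. convergent (\<lambda>N. occ i j N - real N * pmf q j))"
    by (simp add: dt_deviation_exists_def summable_iff_convergent sums)
  have D: "D = (\<lambda>i j. lim (\<lambda>N. occ i j N - real N * pmf q j))"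
    by (simp add: fun_eq_iff D_def dt_deviation_def suminf_eq_lim sums)
  show "K i = K i'" unfolding K by (subst (1 2) occ.K_const) simp
  show "finite (UNIV :: 's set) \<Longrightarrow> dt_deviation_exists P \<pi> \<and> enn2ereal (K i) = ereal (\<Sum>j\<in>UNIV. D j j)"
    using occ.kemeny_formula(1)[of i] by (simp add: ex D K)
  show "dt_deviation_exists P \<pi> \<Longrightarrow> (\<lambda>j. D j j) summable_on UNIV \<Longrightarrow> enn2ereal (K i) = ereal (\<Sum>\<^sub>\<infinity>j. D j j)"
    using occ.kemeny_formula(2)[of i] by (simp add: ex D K)
  show "dt_deviation_exists P \<pi> \<Longrightarrow> \<not> (\<lambda>j. D j j) summable_on UNIV \<Longrightarrow> K i = \<infinity>"
    using occ.kemeny_formula(3)[of i] by (simp add: ex D K)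
  show "\<not> dt_deviation_exists P \<pi> \<Longrightarrow> K i = \<infinity>"
    using occ.kemeny_formula(4)[of i] by (simp add: ex K)
qed

section \<open>Continuous time\<close>

lemma cumulative_integral_diff:
  fixes f :: "real \<Rightarrow> real"
  assumes "continuous_on UNIV f" "0 \<le> a" "a \<le> b"
  shows "integral {0..b} f - integral {0..a} f = integral {a..b} f"
proof -
  have "f integrable_on {0..b}"
    using assms continuous_on_subset by (intro integrable_continuous_real) blast
  then have "integral {0..a} f + integral {a..b} f = integral {0..b} f"
    using assms by (intro Henstock_Kurzweil_Integration.integral_combine) auto
  then show ?thesis by simp
qed

text \<open>A window of fixed length \<open>L\<close> moves to infinity, where \<open>f\<close> is
  nearly constant; the counterpart of \<open>window_sum_tendsto\<close> for real
  \<open>L\<close>.\<close>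

lemma cumulative_integral_window:
  fixes f :: "real \<Rightarrow> real"
  assumes cont: "continuous_on UNIV f" and lim: "(f \<longlongrightarrow> c) at_top" and L: "0 \<le> L"
  shows "(\<lambda>N. integral {0..real N} f - integral {0..real N - L} f) \<longlonglongrightarrow> L * c"
proof (rule LIMSEQ_I)
  fix e :: real assume e: "0 < e"
  \<comment> \<open>The \<open>+ 1\<close> covers \<open>L = 0\<close> and makes
    \<open>e' * L < e\<close> strict.\<close>
  define e' where "e' = e / (L + 1)"
  have e': "0 < e'" "e' * L < e"
    using e L by (auto simp: e'_def field_simps)
  have "\<forall>\<^sub>F t in at_top. dist (f t) c < e'" using lim e' by (simp add: tendstoD)
  then obtain T where T: "\<And>t. t \<ge> T \<Longrightarrow> \<bar>f t - c\<bar> < e'"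
    by (auto simp: eventually_at_top_linorder dist_real_def)
  \<comment> \<open>Beyond \<open>N0\<close> the window lies to the right of both \<open>T\<close>
    and 0.\<close>
  obtain N0 :: nat where N0: "max T 0 + L \<le> real N0" using real_arch_simple by blast
  have "norm (integral {0..real N} f - integral {0..real N - L} f - L * c) < e" if N: "N \<ge> N0" for N
  proof -
    let ?I = "{real N - L..real N}"
    have NL: "T \<le> real N - L" "0 \<le> real N - L" using N0 N by auto
    have contI: "continuous_on ?I f" using cont continuous_on_subset by blast
    have "integral {0..real N} f - integral {0..real N - L} f - L * c = integral ?I f - integral ?I (\<lambda>_. c)"
      using NL L cumulative_integral_diff[OF cont, of "real N - L" "real N"] by simp
    also have "\<dots> = integral ?I (\<lambda>t. f t - c)"
      using contI by (intro Henstock_Kurzweil_Integration.integral_diff[symmetric] integrable_continuous_real) auto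
    also have "norm \<dots> \<le> e' * (real N - (real N - L))"
    proof (rule integral_bound)
      show "continuous_on ?I (\<lambda>t. f t - c)" by (intro continuous_intros contI)
      show "norm (f t - c) \<le> e'" if "t \<in> ?I" for t
        using T[of t] that NL by simp
    qed (use L in simp)
    finally show ?thesis using e' by simp
  qed
  then show "\<exists>N0. \<forall>N\<ge>N0. norm (integral {0..real N} f - integral {0..real N - L} f - L * c) < e" by blast
qed

text \<open>Because \<open>f\<close> vanishes at infinity, the piece between a real endpoint and its
  integer part is negligible, so integer endpoints already decide convergence.\<close>

lemma has_integral_halfline_iff:
  fixes f :: "real \<Rightarrow> real"
  assumes cont: "continuous_on UNIV f" and lim: "(f \<longlongrightarrow> 0) at_top"
  shows "(f has_integral I) {0..} \<longleftrightarrow> (\<lambda>N. integral {0..real N} f) \<longlonglongrightarrow> I"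
proof
  have restrict: "integral (cbox a b) (\<lambda>x. if x \<in> {0..} then f x else 0) = integral {0..b} f" if "a \<le> 0" for a b
  proof -
    have "max 0 a = 0" using that by simp
    then show ?thesis using integral_restrict_Int[of "cbox a b" "{0..}" f] by simp
  qed
  {
    assume I: "(f has_integral I) {0..}"
    show "(\<lambda>N. integral {0..real N} f) \<longlonglongrightarrow> I"
    proof (rule LIMSEQ_I)
      fix e :: real assume "0 < e"
      then obtain B where B: "\<And>a b. ball 0 B \<subseteq> cbox a b \<Longrightarrow>
          norm (integral (cbox a b) (\<lambda>x. if x \<in> {0..} then f x else 0) - I) < e"
        using I unfolding has_integral_alt' by blast
      obtain N0 :: nat where N0: "B \<le> real N0" using real_arch_simple by blast
      have "norm (integral {0..real N} f - I) < e" if "N \<ge> N0" for N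
      proof -
        have "ball 0 B \<subseteq> cbox (- real N) (real N)" using that N0 by (auto simp: dist_real_def)
        from B[OF this] show ?thesis by (subst (asm) restrict) auto
      qed
      then show "\<exists>N0. \<forall>N\<ge>N0. norm (integral {0..real N} f - I) < e" by blast
    qed
  next
    assume I: "(\<lambda>N. integral {0..real N} f) \<longlonglongrightarrow> I"
    show "(f has_integral I) {0..}"
      unfolding has_integral_alt'
    proof (intro conjI allI impI)
      fix a b :: real
      have "{0..} \<inter> {a..b} = {max 0 a..b}" by auto
      moreover have "f integrable_on {max 0 a..b}"
        using cont continuous_on_subset by (intro integrable_continuous_real) blast
      ultimately show "(\<lambda>x. if x \<in> {0..} then f x else 0) integrable_on cbox a b"
        by (subst integrable_restrict_Int) simp
    next
      fix e :: real assume e: "0 < e"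
      obtain N0 where N0: "\<And>N. N \<ge> N0 \<Longrightarrow> norm (integral {0..real N} f - I) < e / 2"
        using LIMSEQ_D[OF I, of "e / 2"] e by auto
      have "\<forall>\<^sub>F t in at_top. dist (f t) 0 < e / 2" using lim e by (intro tendstoD) auto
      then obtain T where T: "\<And>t. t \<ge> T \<Longrightarrow> \<bar>f t\<bar> < e / 2"
        by (auto simp: eventually_at_top_linorder dist_real_def)
      \<comment> \<open>The \<open>+ 1\<close> leaves room for rounding \<open>b\<close> down: its
        integer part is still at least \<open>N0\<close> and \<open>T\<close>.\<close>
      define B where "B = max (real N0) (max T 0) + 1"
      have "norm (integral (cbox a b) (\<lambda>x. if x \<in> {0..} then f x else 0) - I) < e"
        if "ball 0 B \<subseteq> cbox a b" for a b
      proof -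
        have "{- B<..<B} \<subseteq> {a..b}" using that by (simp add: ball_eq_greaterThanLessThan)
        then have ab: "a \<le> - B" "B \<le> b"
          by (auto simp: greaterThanLessThan_subseteq_atLeastAtMost_iff B_def)
        define N where "N = nat \<lfloor>b\<rfloor>"
        have N: "real N \<le> b" "b - real N \<le> 1" "N0 \<le> N" "T \<le> real N"
          using ab unfolding N_def B_def by linarith+
        have "integral {0..b} f - I = (integral {0..real N} f - I) + integral {real N..b} f"
          using cumulative_integral_diff[OF cont, of "real N" b] N by simp
        also have "norm \<dots> < e"
        proof (rule norm_triangle_lt)
          have "norm (integral {real N..b} f) \<le> e / 2 * (b - real N)"
          proof (rule integral_bound)
            show "continuous_on {real N..b} f" using cont continuous_on_subset by blast
            show "norm (f t) \<le> e / 2" if "t \<in> {real N..b}" for t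
              using T[of t] that N by simp
          qed (use N in simp)
          also have "\<dots> \<le> e / 2 * 1" using N e by (intro mult_left_mono) auto
          finally have "norm (integral {real N..b} f) \<le> e / 2" by simp
          with N0[OF N(3)] show "norm (integral {0..real N} f - I) + norm (integral {real N..b} f) < e" by linarith
        qed
        finally show ?thesis using ab by (subst restrict) (auto simp: B_def)
      qed
      moreover have "0 < B" by (simp add: B_def)
      ultimately show "\<exists>B>0. \<forall>a b. ball 0 B \<subseteq> cbox a b \<longrightarrow>
          norm (integral (cbox a b) (\<lambda>x. if x \<in> {0..} then f x else 0) - I) < e" by blast
    qed
  }
qed

lemma
  fixes f :: "real \<Rightarrow> real"
  assumes "continuous_on UNIV f" "(f \<longlongrightarrow> 0) at_top"
  shows integrable_on_halfline_iff: "f integrable_on {0..} \<longleftrightarrow> convergent (\<lambda>N. integral {0..real N} f)"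
    and integral_halfline_eq_lim:
      "f integrable_on {0..} \<Longrightarrow> integral {0..} f = lim (\<lambda>N. integral {0..real N} f)"
  using has_integral_halfline_iff[OF assms]
  by (auto simp: integrable_on_def convergent_def limI intro: integral_unique)

lemma nn_integral_cumulative:
  fixes f :: "real \<Rightarrow> real"
  assumes "continuous_on UNIV f" "\<And>t. 0 \<le> f t"
  shows "(\<integral>\<^sup>+t. ennreal (f t) * indicator {0..x} t \<partial>lborel) = ennreal (integral {0..x} f)"
proof -
  have "f integrable_on {0..x}"
    using assms continuous_on_subset by (intro integrable_continuous_real) blast
  then have "(\<integral>\<^sup>+t. ennreal (indicator {0..x} t * f t) \<partial>lborel) = ennreal (integral {0..x} f)"
    using assms by (intro nn_integral_has_integral_lebesgue integrable_integral) auto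
  then show ?thesis using assms(2) by (simp add: ennreal_mult ennreal_indicator mult.commute)
qed

section \<open>The transition semigroup of a continuous-time chain\<close>

locale ct_chain =
  fixes Q :: "'s::countable \<Rightarrow> 's \<Rightarrow> real" and M :: "'s \<Rightarrow> 'w measure" and X :: "real \<Rightarrow> 'w \<Rightarrow> 's"
  assumes chain: "ct_markov_chain Q M X"
begin

lemma prob_space_M: "prob_space (M i)"
  using chain by (simp add: ct_markov_chain_def)

lemma measurable_X: "0 \<le> t \<Longrightarrow> X t \<in> M i \<rightarrow>\<^sub>M count_space UNIV"
  using chain by (simp add: ct_markov_chain_def)

lemma X_0: "AE \<omega> in M i. X 0 \<omega> = i"
  using chain by (simp add: ct_markov_chain_def)

lemma right_continuous: "AE \<omega> in M i. \<forall>t\<ge>0. \<forall>\<^sub>F s in at_right t. X s \<omega> = X t \<omega>"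
  using chain by (simp add: ct_markov_chain_def)

lemma markov:
  assumes "0 \<le> t 0" "\<And>k. k \<le> n \<Longrightarrow> t k < t (Suc k)"
    and "\<P>(\<omega> in M i. \<forall>k\<le>n. X (t k) \<omega> = x k) > 0"
  shows "\<P>(\<omega> in M i. X (t (Suc n)) \<omega> = j \<bar> \<forall>k\<le>n. X (t k) \<omega> = x k)
    = ct_transition M X (t (Suc n) - t n) (x n) j"
proof -
  have "\<forall>i n t x j. 0 \<le> t 0 \<and> (\<forall>k\<le>n. t k < t (Suc k)) \<longrightarrow>
      \<P>(\<omega> in M i. \<forall>k\<le>n. X (t k) \<omega> = x k) > 0 \<longrightarrow>
      \<P>(\<omega> in M i. X (t (Suc n)) \<omega> = j \<bar> \<forall>k\<le>n. X (t k) \<omega> = x k)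
        = ct_transition M X (t (Suc n) - t n) (x n) j"
    using chain unfolding ct_markov_chain_def by (elim conjE)
  then show ?thesis using assms by simp
qed

lemma generator:
  "((\<lambda>h. (ct_transition M X h i j - (if i = j then 1 else 0)) / h) \<longlongrightarrow> Q i j) (at_right 0)"
proof -
  have "\<forall>i j. ((\<lambda>h. (ct_transition M X h i j - (if i = j then 1 else 0)) / h) \<longlongrightarrow> Q i j) (at_right 0)"
    using chain unfolding ct_markov_chain_def by (elim conjE)
  then show ?thesis by blast
qed

text \<open>Clipping at \<open>0\<close> makes the transition function total and continuous on the whole line.\<close>

definition tp :: "real \<Rightarrow> 's \<Rightarrow> 's pmf" where
  "tp t i = embed_pmf (ct_transition M X (max 0 t) i)"

lemma pmf_tp_eq: "pmf (tp t i) j = ct_transition M X (max 0 t) i j"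
  unfolding tp_def
proof (rule pmf_embed_pmf)
  interpret prob_space "M i" by (rule prob_space_M)
  show "0 \<le> ct_transition M X (max 0 t) i x" for x by (simp add: ct_transition_def)
  have [measurable]: "X (max 0 t) \<in> M i \<rightarrow>\<^sub>M count_space UNIV" by (simp add: measurable_X)
  have "1 = emeasure (M i) {\<omega>\<in>space (M i). True}" by (simp add: emeasure_space_1)
  also have "\<dots> = (\<integral>\<^sup>+j. emeasure (M i) {\<omega>\<in>space (M i). True \<and> X (max 0 t) \<omega> = j} \<partial>count_space UNIV)"
    by (intro emeasure_split_countable) measurable
  finally show "(\<integral>\<^sup>+j. ennreal (ct_transition M X (max 0 t) i j) \<partial>count_space UNIV) = 1"
    by (simp add: ct_transition_def emeasure_eq_measure)
qed

lemma emeasure_X: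
  assumes "0 \<le> t"
  shows "emeasure (M i) {\<omega>\<in>space (M i). X t \<omega> = j} = ennreal (pmf (tp t i) j)"
proof -
  interpret prob_space "M i" by (rule prob_space_M)
  show ?thesis using assms by (simp add: pmf_tp_eq ct_transition_def emeasure_eq_measure)
qed

lemma tp_0: "tp 0 i = return_pmf i"
proof -
  interpret prob_space "M i" by (rule prob_space_M)
  have [measurable]: "X 0 \<in> M i \<rightarrow>\<^sub>M count_space UNIV" by (simp add: measurable_X)
  have "emeasure (M i) {\<omega>\<in>space (M i). X 0 \<omega> = i} = 1"
    using X_0[of i] by (intro emeasure_eq_1_AE) auto
  then have "pmf (tp 0 i) i = 1" using emeasure_X[of 0 i i] by simp
  then have "measure_pmf.prob (tp 0 i) {i} = 1" by (simp add: measure_pmf_single)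
  then have "AE k in tp 0 i. k = i" by (subst (asm) measure_pmf.prob_eq_1) auto
  then show ?thesis by (simp add: AE_measure_pmf_iff set_pmf_subset_singleton[symmetric] subset_iff)
qed

text \<open>The Markov property with a single observation time; it speaks of strictly increasing
  times, hence \<open>0 < t\<close>, and of conditions of positive probability, hence the case
  split.\<close>

lemma markov_two:
  assumes s: "0 \<le> s" and t: "0 < t"
  shows "emeasure (M i) {\<omega>\<in>space (M i). X (s + t) \<omega> = j \<and> X s \<omega> = k}
    = ennreal (pmf (tp s i) k) * ennreal (pmf (tp t k) j)"
proof -
  interpret prob_space "M i" by (rule prob_space_M)
  have [measurable]: "X s \<in> M i \<rightarrow>\<^sub>M count_space UNIV" "X (s + t) \<in> M i \<rightarrow>\<^sub>M count_space UNIV"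
    using s t by (auto intro: measurable_X)
  let ?A = "{\<omega>\<in>space (M i). X s \<omega> = k}"
  let ?B = "{\<omega>\<in>space (M i). X (s + t) \<omega> = j \<and> X s \<omega> = k}"
  have A: "prob ?A = pmf (tp s i) k"
    using s by (simp add: pmf_tp_eq ct_transition_def)
  have "prob ?B = prob ?A * pmf (tp t k) j"
  proof (cases "prob ?A = 0")
    case True
    moreover have "prob ?B \<le> prob ?A" by (intro finite_measure_mono) auto
    ultimately show ?thesis by (simp add: measure_le_0_iff)
  next
    case False
    then have pos: "prob ?A > 0" by (simp add: zero_less_measure_iff)
    define tt where "tt l = s + real l * t" for l
    have "\<P>(\<omega> in M i. X (tt (Suc 0)) \<omega> = j \<bar> \<forall>l\<le>0. X (tt l) \<omega> = k) = ct_transition M X (tt (Suc 0) - tt 0) k j"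
      by (rule markov[where x="\<lambda>_. k"]) (use s t pos in \<open>auto simp: tt_def\<close>)
    then have "\<P>(\<omega> in M i. X (s + t) \<omega> = j \<bar> X s \<omega> = k) = ct_transition M X t k j"
      by (simp add: tt_def)
    then show ?thesis
      using False t by (simp add: cond_prob_def pmf_tp_eq field_simps)
  qed
  then show ?thesis by (simp add: A emeasure_eq_measure ennreal_mult)
qed

text \<open>Chapman-Kolmogorov, by splitting over the state at time \<open>s\<close>;
  \<open>t = 0\<close> is outside the reach of \<open>markov_two\<close> and uses
  \<open>tp_0\<close>.\<close>

lemma tp_add:
  assumes "0 \<le> s" "0 \<le> t"
  shows "tp (s + t) i = bind_pmf (tp s i) (tp t)"
proof (cases "t = 0")
  case True
  then show ?thesis by (simp add: tp_0[abs_def] bind_return_pmf')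
next
  case False
  show ?thesis
  proof (rule pmf_eqI)
    fix j
    have [measurable]: "X s \<in> M i \<rightarrow>\<^sub>M count_space UNIV" "X (s + t) \<in> M i \<rightarrow>\<^sub>M count_space UNIV"
      using assms by (auto intro: measurable_X)
    have "ennreal (pmf (tp (s + t) i) j) = emeasure (M i) {\<omega>\<in>space (M i). X (s + t) \<omega> = j}"
      using assms by (simp add: emeasure_X)
    also have "\<dots> = (\<integral>\<^sup>+k. emeasure (M i) {\<omega>\<in>space (M i). X (s + t) \<omega> = j \<and> X s \<omega> = k} \<partial>count_space UNIV)"
      by (intro emeasure_split_countable) measurable
    also have "\<dots> = (\<integral>\<^sup>+k. ennreal (pmf (tp t k) j) \<partial>tp s i)"
      using assms False by (simp add: markov_two nn_integral_measure_pmf)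
    finally show "pmf (tp (s + t) i) j = pmf (bind_pmf (tp s i) (tp t)) j"
      by (simp flip: ennreal_pmf_bind)
  qed
qed

lemma kpow_tp: "0 \<le> h \<Longrightarrow> kpow (tp h) n = tp (real n * h)"
proof (induction n)
  case (Suc n)
  then have "kpow (tp h) (Suc n) = (\<lambda>i. bind_pmf (tp h i) (tp (real n * h)))" by simp
  also have "\<dots> = tp (real (Suc n) * h)"
    using Suc.prems by (simp add: fun_eq_iff tp_add[symmetric] algebra_simps)
  finally show ?case .
qed (simp add: fun_eq_iff tp_0)

lemma skeleton:
  assumes h: "0 < h"
  shows "dt_chain (tp h) M (\<lambda>n. X (real n * h))"
proof
  have "stochastic_matrix (\<lambda>i. pmf (tp h i))"
    using has_sum_pmf_integral[of _ "\<lambda>_. 1"] by (auto simp: stochastic_matrix_def prob_dist_def)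
  moreover have "\<P>(\<omega> in M i. X (real (Suc n) * h) \<omega> = j \<bar> \<forall>k\<le>n. X (real k * h) \<omega> = x k) = pmf (tp h (x n)) j"
    if "\<P>(\<omega> in M i. \<forall>k\<le>n. X (real k * h) \<omega> = x k) > 0" for i n x j
  proof -
    define tt where "tt l = real l * h" for l
    have "\<P>(\<omega> in M i. X (tt (Suc n)) \<omega> = j \<bar> \<forall>k\<le>n. X (tt k) \<omega> = x k) = ct_transition M X (tt (Suc n) - tt n) (x n) j"
      by (rule markov) (use h that in \<open>auto simp: tt_def\<close>)
    moreover have "tt (Suc n) - tt n = h" by (simp add: tt_def algebra_simps)
    ultimately show ?thesis using h by (simp add: tt_def pmf_tp_eq)
  qed
  ultimately show "dt_markov_chain (\<lambda>i. pmf (tp h i)) M (\<lambda>n. X (real n * h))"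
    unfolding dt_markov_chain_def using prob_space_M X_0 measurable_X h by auto
qed

lemma tp_mult_le:
  assumes "0 \<le> s" "0 \<le> t"
  shows "pmf (tp s i) k * pmf (tp t k) j \<le> pmf (tp (s + t) i) j"
  unfolding tp_add[OF assms] pmf_bind
  by (intro pmf_mult_le_integral integrable_pmf_bounded[where B=1]) (auto simp: pmf_le_1)

text \<open>Run for time \<open>s\<close> first: if the chain is then in \<open>i\<close>, the
  remaining time \<open>t\<close> contributes no discrepancy, so at most the mass elsewhere matters.
  The bound is independent of \<open>t\<close>, which makes continuity uniform.\<close>

lemma tp_increment:
  assumes "0 \<le> s" "0 \<le> t"
  shows "\<bar>pmf (tp (s + t) i) j - pmf (tp t i) j\<bar> \<le> 1 - pmf (tp s i) i"
proof -
  have int: "integrable (measure_pmf (tp s i)) (\<lambda>k. pmf (tp t k) j)"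
    by (intro integrable_pmf_bounded[where B=1]) (simp add: pmf_le_1)
  \<comment> \<open>The one-term bound applied to the complement gives the upper estimate;
    \<open>tp_mult_le\<close> gives the lower one.\<close>
  have "pmf (tp s i) i * (1 - pmf (tp t i) j) \<le> (\<integral>k. 1 - pmf (tp t k) j \<partial>tp s i)"
    by (intro pmf_mult_le_integral integrable_pmf_bounded[where B=1]) (auto simp: pmf_le_1)
  also have "\<dots> = 1 - pmf (tp (s + t) i) j"
    using int by (simp add: tp_add[OF assms] pmf_bind)
  finally have "pmf (tp (s + t) i) j \<le> 1 - pmf (tp s i) i + pmf (tp s i) i * pmf (tp t i) j"
    by (simp add: algebra_simps)
  moreover have "pmf (tp s i) i * pmf (tp t i) j \<le> pmf (tp (s + t) i) j" by (rule tp_mult_le[OF assms])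
  moreover have "pmf (tp s i) i * pmf (tp t i) j \<le> 1 * pmf (tp t i) j"
    by (intro mult_right_mono) (auto simp: pmf_le_1)
  moreover have "(1 - pmf (tp s i) i) * pmf (tp t i) j \<le> (1 - pmf (tp s i) i) * 1"
    by (intro mult_left_mono) (auto simp: pmf_le_1)
  ultimately show ?thesis by (simp add: abs_le_iff algebra_simps)
qed

text \<open>A finite derivative at 0 forces continuity there: the difference quotient is multiplied
  by \<open>h\<close>.\<close>

lemma tp_near_0:
  assumes e: "0 < e"
  shows "\<exists>\<delta>>0. \<forall>s. 0 \<le> s \<and> s < \<delta> \<longrightarrow> 1 - pmf (tp s i) i < e"
proof -
  have "((\<lambda>h. (ct_transition M X h i i - 1) / h) \<longlongrightarrow> Q i i) (at_right 0)"
    using generator[of i i] by simp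
  then have "((\<lambda>h. (ct_transition M X h i i - 1) / h * h) \<longlongrightarrow> Q i i * 0) (at_right 0)"
    by (intro tendsto_mult tendsto_ident_at)
  then have "\<forall>\<^sub>F h in at_right 0. dist ((ct_transition M X h i i - 1) / h * h) 0 < e"
    using e by (intro tendstoD) auto
  then obtain \<delta> where "0 < \<delta>" and \<delta>: "\<And>h. 0 < h \<Longrightarrow> h < \<delta> \<Longrightarrow> \<bar>(ct_transition M X h i i - 1) / h * h\<bar> < e"
    by (auto simp: eventually_at_right_field dist_real_def)
  have "1 - pmf (tp s i) i < e" if "0 \<le> s" "s < \<delta>" for s
    using \<delta>[of s] that e by (cases "s = 0") (auto simp: tp_0 pmf_tp_eq)
  with \<open>0 < \<delta>\<close> show ?thesis by blast
qed

lemma tp_uniformly_continuous: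
  assumes e: "0 < e"
  shows "\<exists>\<delta>>0. \<forall>t t'. \<bar>t - t'\<bar> < \<delta> \<longrightarrow> \<bar>pmf (tp t i) j - pmf (tp t' i) j\<bar> < e"
proof -
  obtain \<delta> where \<delta>: "0 < \<delta>" "\<And>s. 0 \<le> s \<Longrightarrow> s < \<delta> \<Longrightarrow> 1 - pmf (tp s i) i < e"
    using tp_near_0[OF e] by blast
  have clip: "tp t i = tp (max 0 t) i" for t by (simp add: tp_def)
  have le: "\<bar>pmf (tp t' i) j - pmf (tp t i) j\<bar> < e" if "t \<le> t'" "t' - t < \<delta>" for t t'
  proof -
    \<comment> \<open>Clipping does not increase distances, so \<open>s < \<delta>\<close> for times
      of either sign.\<close>
    define s where "s = max 0 t' - max 0 t"
    have s: "0 \<le> s" "s < \<delta>" using that \<delta> by (auto simp: s_def max_def)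
    have "\<bar>pmf (tp (s + max 0 t) i) j - pmf (tp (max 0 t) i) j\<bar> \<le> 1 - pmf (tp s i) i"
      by (rule tp_increment) (use s in auto)
    also have "\<dots> < e" using \<delta> s by blast
    finally show ?thesis by (subst (1 2) clip) (simp add: s_def)
  qed
  show ?thesis
  proof (intro exI[of _ \<delta>] conjI allI impI \<delta>(1))
    fix t t' :: real assume "\<bar>t - t'\<bar> < \<delta>"
    then show "\<bar>pmf (tp t i) j - pmf (tp t' i) j\<bar> < e"
      using le[of t t'] le[of t' t] by (cases "t \<le> t'") (auto simp: abs_minus_commute)
  qed
qed

lemma continuous_tp: "continuous_on UNIV (\<lambda>t. pmf (tp t i) j)"
  unfolding continuous_on_iff dist_real_def using tp_uniformly_continuous[of _ i j] by (metis UNIV_I)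

lemma measurable_tp [measurable]: "(\<lambda>t. pmf (tp t i) j) \<in> borel_measurable borel"
  using continuous_tp by (rule borel_measurable_continuous_onI)

text \<open>Cut \<open>t\<close> into \<open>n\<close> pieces so short that each keeps the chain at
  \<open>i\<close> with positive probability. In continuous time this takes the place of
  aperiodicity.\<close>

lemma tp_diag_pos:
  assumes t: "0 \<le> t"
  shows "0 < pmf (tp t i) i"
proof -
  obtain \<delta> where \<delta>: "0 < \<delta>" "\<And>s. 0 \<le> s \<Longrightarrow> s < \<delta> \<Longrightarrow> 1 - pmf (tp s i) i < 1"
    using tp_near_0[OF zero_less_one] by blast
  obtain n where n: "t / \<delta> < real n" using reals_Archimedean2 by blast
  then have "0 < real n" using t \<delta> by (smt (verit) divide_nonneg_pos)
  define h where "h = t / real n"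
  have h: "0 \<le> h" "h < \<delta>" "real n * h = t"
    using n t \<delta> \<open>0 < real n\<close> by (auto simp: h_def field_simps)
  have "0 < pmf (kpow (tp h) m i) i" for m
  proof (induction m)
    case (Suc m)
    have "0 < pmf (kpow (tp h) (Suc 0) i) i" using \<delta>(2)[of h] h by (simp only: kpow_1) simp
    with Suc have "0 < pmf (kpow (tp h) (Suc 0) i) i * pmf (kpow (tp h) m i) i" by simp
    also have "\<dots> \<le> pmf (kpow (tp h) (Suc 0 + m) i) i" by (rule pmf_kpow_mult_le)
    finally show ?case by simp
  qed simp
  from this[of n] show ?thesis using h by (simp add: kpow_tp)
qed

end

text \<open>An infimum over countably many times, hence measurable; for right-continuous paths it agrees with
  the hitting time.\<close>

definition rat_hitting_time :: "(real \<Rightarrow> 'w \<Rightarrow> 's) \<Rightarrow> 's \<Rightarrow> 'w \<Rightarrow> ennreal" where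
  "rat_hitting_time X j \<omega> = (INF r\<in>\<rat> \<inter> {0..}. if X r \<omega> = j then ennreal r else \<infinity>)"

section \<open>Hitting times of right-continuous paths\<close>

lemma right_continuous_interval:
  assumes "\<forall>\<^sub>F s in at_right t. X s \<omega> = X t \<omega>"
  obtains b :: real where "t < b" "\<And>s. t \<le> s \<Longrightarrow> s < b \<Longrightarrow> X s \<omega> = X t \<omega>"
proof -
  obtain b where "t < b" "\<And>s. t < s \<Longrightarrow> s < b \<Longrightarrow> X s \<omega> = X t \<omega>"
    using assms by (auto simp: eventually_at_right_field)
  then show ?thesis by (intro that[of b]) (auto simp: le_less)
qed

text \<open>From the infimum \<open>\<tau>\<close> of the visits on, right-continuity keeps the path
  constant up to some \<open>b\<close>; a visit occurs before \<open>b\<close>, so the path is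
  already in \<open>j\<close> at \<open>\<tau>\<close>. Rationals in between come arbitrarily close
  to \<open>\<tau>\<close>, hence the two infima agree.\<close>

lemma first_hit_attained:
  fixes X :: "real \<Rightarrow> 'w \<Rightarrow> 's"
  assumes rc: "\<And>t. 0 \<le> t \<Longrightarrow> \<forall>\<^sub>F s in at_right t. X s \<omega> = X t \<omega>" and t: "0 \<le> t" "X t \<omega> = j"
  obtains \<tau> b where "0 \<le> \<tau>" "\<tau> < b" "\<And>s. 0 \<le> s \<Longrightarrow> X s \<omega> = j \<Longrightarrow> \<tau> \<le> s"
    "\<And>s. \<tau> \<le> s \<Longrightarrow> s < b \<Longrightarrow> X s \<omega> = j"
    "ct_hitting_time X j \<omega> = ennreal \<tau>" "rat_hitting_time X j \<omega> = ennreal \<tau>"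
proof -
  define A where "A = {t. 0 \<le> t \<and> X t \<omega> = j}"
  define \<tau> where "\<tau> = Inf A"
  have A: "A \<noteq> {}" "bdd_below A" using t by (auto simp: A_def intro: bdd_belowI[of _ 0])
  have \<tau>0: "0 \<le> \<tau>" unfolding \<tau>_def using A by (intro cInf_greatest) (auto simp: A_def)
  have low: "\<tau> \<le> s" if "0 \<le> s" "X s \<omega> = j" for s
    unfolding \<tau>_def using A that by (intro cInf_lower) (auto simp: A_def)
  obtain b where b: "\<tau> < b" "\<And>s. \<tau> \<le> s \<Longrightarrow> s < b \<Longrightarrow> X s \<omega> = X \<tau> \<omega>"
    using right_continuous_interval[of X \<omega> \<tau>, OF rc[OF \<tau>0]] by blast
  obtain s where "s \<in> A" "s < b" using A b(1) unfolding \<tau>_def by (meson cInf_lessD)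
  then have "X \<tau> \<omega> = j" using b(2)[of s] low[of s] by (auto simp: A_def)
  with b have stay: "\<And>s. \<tau> \<le> s \<Longrightarrow> s < b \<Longrightarrow> X s \<omega> = j" by simp
  have "ct_hitting_time X j \<omega> = ennreal \<tau>"
    unfolding ct_hitting_time_def
  proof (rule antisym)
    show "(INF t\<in>{t. 0 \<le> t \<and> X t \<omega> = j}. ennreal t) \<le> ennreal \<tau>"
      using \<tau>0 \<open>X \<tau> \<omega> = j\<close> by (intro INF_lower) auto
    show "ennreal \<tau> \<le> (INF t\<in>{t. 0 \<le> t \<and> X t \<omega> = j}. ennreal t)"
      using low by (intro INF_greatest ennreal_leI) auto
  qed
  moreover have "rat_hitting_time X j \<omega> = ennreal \<tau>"
  proof (rule antisym)
    show "ennreal \<tau> \<le> rat_hitting_time X j \<omega>"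
      unfolding rat_hitting_time_def using low by (intro INF_greatest) (auto intro: ennreal_leI)
    show "rat_hitting_time X j \<omega> \<le> ennreal \<tau>"
    proof (rule ennreal_le_epsilon)
      fix e :: real assume "0 < e"
      then obtain r where r: "r \<in> \<rat>" "\<tau> < r" "r < min b (\<tau> + e)"
        using Rats_dense_in_real[of \<tau> "min b (\<tau> + e)"] b by auto
      have "rat_hitting_time X j \<omega> \<le> ennreal r"
        unfolding rat_hitting_time_def using r \<tau>0 stay[of r] by (intro INF_lower2[of r]) auto
      also have "\<dots> \<le> ennreal (\<tau> + e)" using r by (intro ennreal_leI) auto
      finally show "rat_hitting_time X j \<omega> \<le> ennreal \<tau> + ennreal e"
        using \<tau>0 \<open>0 < e\<close> by (simp add: ennreal_plus)
    qed
  qed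
  ultimately show ?thesis using that[OF \<tau>0 b(1) low stay] by blast
qed

lemma rat_hitting_time_eq:
  assumes rc: "\<And>t. 0 \<le> t \<Longrightarrow> \<forall>\<^sub>F s in at_right t. X s \<omega> = X t \<omega>"
  shows "rat_hitting_time X j \<omega> = ct_hitting_time X j \<omega>"
proof (cases "\<exists>t\<ge>0. X t \<omega> = j")
  case True
  then show ?thesis using first_hit_attained[of X \<omega>, OF rc] by metis
next
  case False
  then have "ct_hitting_time X j \<omega> = \<infinity>" by (auto simp: ct_hitting_time_def)
  moreover have "rat_hitting_time X j \<omega> = \<infinity>"
    using False by (auto simp: rat_hitting_time_def INF_top_conv)
  ultimately show ?thesis by simp
qed

text \<open>The path stays in \<open>j\<close> from \<open>\<tau>\<close> up to \<open>b\<close>, so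
  a grid of mesh below \<open>b - \<tau>\<close> cannot miss the visit and sees it at most one mesh
  after \<open>\<tau>\<close>. With mesh \<open>T / Suc n\<close> the time \<open>T\<close> is
  always a grid point, which matters when \<open>\<tau> = T\<close>.\<close>

lemma grid_first_hit_tendsto:
  fixes u :: "real \<Rightarrow> ennreal"
  assumes rc: "\<And>t. 0 \<le> t \<Longrightarrow> \<forall>\<^sub>F s in at_right t. X s \<omega> = X t \<omega>"
    and T: "0 < T" and cont: "continuous_on UNIV u"
  shows "(\<lambda>n. if \<exists>m\<le>Suc n. X (real m * (T / real (Suc n))) \<omega> = j
      then u (real (Suc n - (LEAST m. X (real m * (T / real (Suc n))) \<omega> = j)) * (T / real (Suc n))) else 0)
    \<longlonglongrightarrow> (if rat_hitting_time X j \<omega> \<le> ennreal T then u (T - enn2real (rat_hitting_time X j \<omega>)) else 0)"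
    (is "?f \<longlonglongrightarrow> _")
proof (cases "\<exists>t\<ge>0. X t \<omega> = j")
  case False
  then have "ct_hitting_time X j \<omega> = \<infinity>" by (auto simp: ct_hitting_time_def)
  moreover have "X (real m * (T / real (Suc n))) \<omega> \<noteq> j" for m n using False T by auto
  ultimately show ?thesis by (simp add: rat_hitting_time_eq[of X \<omega>, OF rc] top_unique)
next
  case True
  then obtain \<tau> b where \<tau>: "0 \<le> \<tau>" "\<tau> < b" and low: "\<And>s. 0 \<le> s \<Longrightarrow> X s \<omega> = j \<Longrightarrow> \<tau> \<le> s"
    and stay: "\<And>s. \<tau> \<le> s \<Longrightarrow> s < b \<Longrightarrow> X s \<omega> = j" and eq: "rat_hitting_time X j \<omega> = ennreal \<tau>"
    using first_hit_attained[of X \<omega>, OF rc] by metis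
  define h where "h n = T / real (Suc n)" for n
  have h: "0 < h n" "real (Suc n) * h n = T" for n using T by (auto simp: h_def)
  define L where "L n = (LEAST m. X (real m * h n) \<omega> = j)" for n
  have L: "X (real (L n) * h n) \<omega> = j \<and> L n \<le> m" if "X (real m * h n) \<omega> = j" for n m
    unfolding L_def using that by (auto intro: LeastI Least_le)
  have f: "?f n = (if \<exists>m\<le>Suc n. X (real m * h n) \<omega> = j then u (real (Suc n - L n) * h n) else 0)" for n
    unfolding h_def L_def by (rule refl)
  consider "T < \<tau>" | "\<tau> = T" | "\<tau> < T" by linarith
  then show ?thesis
  proof cases
    case 1
    have "X (real m * h n) \<omega> \<noteq> j" if "m \<le> Suc n" for m n
    proof
      assume "X (real m * h n) \<omega> = j"
      then have "\<tau> \<le> real m * h n" using h(1)[of n] by (intro low) auto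
      also have "\<dots> \<le> real (Suc n) * h n" using that h(1)[of n] by (intro mult_right_mono) auto
      finally show False using 1 h(2)[of n] by simp
    qed
    then have "?f n = 0" for n unfolding f by auto
    then show ?thesis using 1 \<tau> T by (simp only: eq) simp
  next
    case 2
    have "?f n = u 0" for n
    proof -
      \<comment> \<open>A first hit exactly at \<open>T\<close> is seen by every grid, and only at
        the point \<open>T\<close>, so the value is \<open>u 0\<close> throughout.\<close>
      have T_hit: "X (real (Suc n) * h n) \<omega> = j" using stay[of \<tau>] \<tau> 2 unfolding h(2) by simp
      have "\<tau> \<le> real (L n) * h n" using L[OF T_hit] h(1)[of n] by (intro low) auto
      then have "real (Suc n) * h n \<le> real (L n) * h n" using 2 h(2)[of n] by simp
      then have "Suc n \<le> L n" using h(1)[of n] by (simp del: of_nat_Suc)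
      then show ?thesis unfolding f using T_hit by auto
    qed
    then show ?thesis using 2 \<tau> by (simp only: eq) simp
  next
    case 3
    have h0: "h \<longlonglongrightarrow> 0"
      unfolding h_def using LIMSEQ_Suc[OF lim_const_over_n[of T]] by simp
    \<comment> \<open>The bound \<open>b - \<tau>\<close> puts a grid point where the path stays in
      \<open>j\<close>, the bound \<open>T - \<tau>\<close> keeps it before
      \<open>T\<close>.\<close>
    have "\<forall>\<^sub>F n in sequentially. h n < min (b - \<tau>) (T - \<tau>)"
      using \<tau> 3 by (intro order_tendstoD(2)[OF h0]) simp
    then have ev: "\<forall>\<^sub>F n in sequentially. ?f n = u (T - real (L n) * h n) \<and> \<tau> \<le> real (L n) * h n \<and> real (L n) * h n \<le> \<tau> + h n"
    proof eventually_elim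
      case (elim n)
      \<comment> \<open>The first grid index at or after \<open>\<tau>\<close>.\<close>
      define m where "m = nat \<lceil>\<tau> / h n\<rceil>"
      have "\<tau> / h n \<le> real m" "real m < \<tau> / h n + 1"
        using \<tau> h(1)[of n] unfolding m_def by (simp_all add: of_nat_nat zero_le_divide_iff) linarith+
      then have m: "\<tau> \<le> real m * h n" "real m * h n < \<tau> + h n"
        using h(1)[of n] by (simp_all add: field_simps)
      have hit: "X (real m * h n) \<omega> = j" using m elim by (intro stay) auto
      have Lm: "real (L n) * h n \<le> real m * h n"
        using L[OF hit] h(1)[of n] by (intro mult_right_mono) auto
      have "real m * h n < real (Suc n) * h n" using m elim h(2)[of n] by simp
      then have "m \<le> Suc n" using h(1)[of n] by (simp del: of_nat_Suc)
      moreover have "L n \<le> m" using L[OF hit] by simp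
      ultimately have "?f n = u (T - real (L n) * h n)"
        unfolding f using hit h(2)[of n] by (auto simp: of_nat_diff algebra_simps)
      moreover have "\<tau> \<le> real (L n) * h n" using L[OF hit] h(1)[of n] by (intro low) auto
      ultimately show ?case using Lm m by linarith
    qed
    have "(\<lambda>n. real (L n) * h n) \<longlonglongrightarrow> \<tau>"
    proof (rule tendsto_sandwich[where f="\<lambda>_. \<tau>" and h="\<lambda>n. \<tau> + h n"])
      show "(\<lambda>n. \<tau> + h n) \<longlonglongrightarrow> \<tau>" using tendsto_add[OF tendsto_const h0, of \<tau>] by simp
    qed (use ev in \<open>auto elim: eventually_mono\<close>)
    then have "(\<lambda>n. u (T - real (L n) * h n)) \<longlonglongrightarrow> u (T - \<tau>)"
      using cont by (intro continuous_on_tendsto_compose[OF cont] tendsto_diff tendsto_const) auto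
    then have "?f \<longlonglongrightarrow> u (T - \<tau>)"
      using ev by (rule Lim_transform_eventually[OF _ eventually_mono]) auto
    then show ?thesis using 3 \<tau> T by (simp only: eq) simp
  qed
qed

context ct_chain
begin

lemma measurable_rat_hitting_time [measurable]: "rat_hitting_time X j \<in> borel_measurable (M i)"
proof -
  have "(\<lambda>\<omega>. if X r \<omega> = j then ennreal r else \<infinity>) \<in> borel_measurable (M i)" if "r \<in> \<rat> \<inter> {0..}" for r
  proof -
    have [measurable]: "X r \<in> M i \<rightarrow>\<^sub>M count_space UNIV" using that by (auto intro: measurable_X)
    show ?thesis by measurable
  qed
  then have "(\<lambda>\<omega>. INF r\<in>\<rat> \<inter> {0..}. if X r \<omega> = j then ennreal r else \<infinity>) \<in> borel_measurable (M i)"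
    using countable_rat by (intro borel_measurable_INF) auto
  then show ?thesis by (simp add: rat_hitting_time_def[abs_def])
qed

lemma AE_rat_hitting_time: "AE \<omega> in M i. rat_hitting_time X j \<omega> = ct_hitting_time X j \<omega>"
  using right_continuous[of i] by eventually_elim (simp add: rat_hitting_time_eq)

lemma ct_mean_hitting_eq: "ct_mean_hitting M X i j = (\<integral>\<^sup>+\<omega>. rat_hitting_time X j \<omega> \<partial>M i)"
proof -
  have "AE \<omega> in M i. ct_hitting_time X j \<omega> = rat_hitting_time X j \<omega>"
    using AE_rat_hitting_time[where i=i and j=j] by eventually_elim simp
  then show ?thesis unfolding ct_mean_hitting_def by (rule nn_integral_cong_AE)
qed

text \<open>The conditional probability of \<open>X T = j\<close> given the hitting time, built on
  the rational version so as to be jointly measurable in \<open>T\<close> and the path.\<close>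

definition passage :: "'s \<Rightarrow> real \<Rightarrow> 'w \<Rightarrow> ennreal" where
  "passage j T \<omega> = (if rat_hitting_time X j \<omega> \<le> ennreal T
    then ennreal (pmf (tp (T - enn2real (rat_hitting_time X j \<omega>)) j) j) else 0)"

lemma measurable_passage: "(\<lambda>(T, \<omega>). passage j T \<omega>) \<in> borel_measurable (borel \<Otimes>\<^sub>M M i)"
  unfolding passage_def by measurable

text \<open>The first passage decomposition holds for every skeleton having \<open>T\<close> on its grid; refining the
  grid gives it in continuous time.\<close>

lemma first_passage:
  assumes T: "0 < T"
  shows "(\<integral>\<^sup>+\<omega>. passage j T \<omega> \<partial>M i) = ennreal (pmf (tp T i) j)"
proof -
  interpret prob_space "M i" by (rule prob_space_M)
  define h where "h n = T / real (Suc n)" for n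
  have h: "0 < h n" "real (Suc n) * h n = T" for n using T by (auto simp: h_def)
  define F where "F n \<omega> = (if \<exists>m\<le>Suc n. X (real m * h n) \<omega> = j
      then ennreal (pmf (tp (real (Suc n - (LEAST m. X (real m * h n) \<omega> = j)) * h n) j) j) else 0)" for n \<omega>
  have F: "F n = (\<lambda>\<omega>. if \<exists>m\<le>Suc n. X (real m * h n) \<omega> = j
      then ennreal (pmf (kpow (tp (h n)) (Suc n - (LEAST m. X (real m * h n) \<omega> = j)) j) j) else 0)" for n
    using h(1)[of n] by (auto simp: F_def fun_eq_iff kpow_tp less_imp_le simp del: kpow.simps of_nat_Suc)
  have meas: "F n \<in> borel_measurable (M i)" for n
    unfolding F by (rule dt_chain.measurable_first_passage[OF skeleton[OF h(1)]])
  have "(\<integral>\<^sup>+\<omega>. F n \<omega> \<partial>M i) = ennreal (pmf (kpow (tp (h n)) (Suc n) i) j)" for n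
    unfolding F by (rule dt_chain.first_passage[OF skeleton[OF h(1)]])
  then have int: "(\<integral>\<^sup>+\<omega>. F n \<omega> \<partial>M i) = ennreal (pmf (tp T i) j)" for n
    using h[of n] by (simp add: kpow_tp less_imp_le del: kpow.simps of_nat_Suc)
  \<comment> \<open>On every grid the integral already has the final value, so only the integrands
    need a limit; they are bounded by 1.\<close>
  have "(\<lambda>n. \<integral>\<^sup>+\<omega>. F n \<omega> \<partial>M i) \<longlonglongrightarrow> (\<integral>\<^sup>+\<omega>. passage j T \<omega> \<partial>M i)"
  proof (rule nn_integral_dominated_convergence[where w="\<lambda>_. 1"])
    show "passage j T \<in> borel_measurable (M i)"
      unfolding passage_def[abs_def] by measurable
    show "AE \<omega> in M i. F n \<omega> \<le> 1" for n by (auto simp: F_def pmf_le_1)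
    have "continuous_on UNIV (\<lambda>t. ennreal (pmf (tp t j) j))"
      by (intro continuous_on_ennreal continuous_tp)
    note grid = grid_first_hit_tendsto[OF _ T this]
    show "AE \<omega> in M i. (\<lambda>n. F n \<omega>) \<longlonglongrightarrow> passage j T \<omega>"
      using right_continuous[of i]
    proof eventually_elim
      case (elim \<omega>)
      show ?case unfolding F_def passage_def h_def by (rule grid) (use elim in blast)
    qed
  qed (auto simp: meas emeasure_space_1)
  then show ?thesis unfolding int by (rule LIMSEQ_unique[OF _ tendsto_const])
qed

end

section \<open>Occupation times in continuous time\<close>

lemma nn_integral_shift_window:
  fixes f :: "real \<Rightarrow> ennreal"
  assumes [measurable]: "f \<in> borel_measurable borel"
  shows "(\<integral>\<^sup>+t. f (t - a) * indicator {a..b} t \<partial>lborel) = (\<integral>\<^sup>+t. f t * indicator {0..b - a} t \<partial>lborel)"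
proof -
  have "(\<integral>\<^sup>+t. f (t - a) * indicator {a..b} t \<partial>lborel)
      = (\<integral>\<^sup>+t. f (a + 1 * t - a) * indicator {a..b} (a + 1 * t) \<partial>lborel)"
    by (subst nn_integral_real_affine[where t=a and c=1]) auto
  also have "\<dots> = (\<integral>\<^sup>+t. f t * indicator {0..b - a} t \<partial>lborel)"
    by (intro nn_integral_cong) (auto split: split_indicator)
  finally show ?thesis .
qed

context ct_chain
begin

text \<open>For \<open>x < 0\<close> the interval is empty and the value 0, which does the work of
  truncated subtraction in the discrete case.\<close>

definition cocc :: "'s \<Rightarrow> 's \<Rightarrow> real \<Rightarrow> real" where
  "cocc i j x = integral {0..x} (\<lambda>t. pmf (tp t i) j)"

lemma integrable_tp: "(\<lambda>t. pmf (tp t i) j) integrable_on {a..b}"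
  using continuous_tp continuous_on_subset by (intro integrable_continuous_real) blast

lemma cocc_nonneg: "0 \<le> cocc i j x"
  unfolding cocc_def by (intro integral_nonneg integrable_tp) auto

lemma nn_cocc: "(\<integral>\<^sup>+t. ennreal (pmf (tp t i) j) * indicator {0..x} t \<partial>lborel) = ennreal (cocc i j x)"
  unfolding cocc_def by (rule nn_integral_cumulative[OF continuous_tp]) simp

lemma cocc_mono: "x \<le> y \<Longrightarrow> cocc i j x \<le> cocc i j y"
  unfolding cocc_def by (intro integral_subset_le integrable_tp) auto

lemma cocc_neg: "x \<le> 0 \<Longrightarrow> cocc i j x = 0"
  by (cases "x = 0") (auto simp: cocc_def)

lemma cocc_diff: "0 \<le> x \<Longrightarrow> x \<le> y \<Longrightarrow> cocc i j y - cocc i j x = integral {x..y} (\<lambda>t. pmf (tp t i) j)"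
  unfolding cocc_def by (rule cumulative_integral_diff[OF continuous_tp])

lemma cocc_diff_le:
  assumes "0 \<le> x" "x \<le> y"
  shows "cocc i j y - cocc i j x \<le> y - x"
proof -
  have "norm (integral {x..y} (\<lambda>t. pmf (tp t i) j)) \<le> 1 * (y - x)"
    using assms continuous_on_subset[OF continuous_tp] by (intro integral_bound) (auto simp: pmf_le_1)
  then show ?thesis using assms by (simp add: cocc_diff)
qed

lemma cocc_le: "0 \<le> x \<Longrightarrow> cocc i j x \<le> x"
  using cocc_diff_le[of 0 x i j] by (simp add: cocc_neg)

lemma cocc_window_le:
  assumes "0 \<le> L" "0 \<le> x"
  shows "cocc i j x - cocc i j (x - L) \<le> L"
proof (cases "L \<le> x")
  case True
  then show ?thesis using cocc_diff_le[of "x - L" x i j] assms by simp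
next
  case False
  then show ?thesis using cocc_le[of x i j] cocc_neg[of "x - L" i j] assms by simp
qed

lemma mean_cocc:
  "(\<integral>\<^sup>+k. ennreal (cocc k j x) \<partial>measure_pmf r) = (\<integral>\<^sup>+t. (\<integral>\<^sup>+k. ennreal (pmf (tp t k) j) \<partial>r) * indicator {0..x} t \<partial>lborel)"
proof -
  have "(\<integral>\<^sup>+k. ennreal (cocc k j x) \<partial>r) = (\<integral>\<^sup>+k. \<integral>\<^sup>+t. ennreal (pmf (tp t k) j) * indicator {0..x} t \<partial>lborel \<partial>r)"
    by (simp add: nn_cocc)
  also have "\<dots> = (\<integral>\<^sup>+t. \<integral>\<^sup>+k. ennreal (pmf (tp t k) j) * indicator {0..x} t \<partial>r \<partial>lborel)"
    by (rule nn_integral_pmf_swap[symmetric]) measurable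
  finally show ?thesis by (simp add: nn_integral_multc)
qed

lemma integral_cocc:
  assumes "0 \<le> c" and eq: "(\<integral>\<^sup>+k. ennreal (cocc k j x) \<partial>measure_pmf r) = ennreal c"
  shows "(\<integral>k. cocc k j x \<partial>r) = c"
  using eq \<open>0 \<le> c\<close> cocc_nonneg by (subst integral_eq_nn_integral) auto

text \<open>By Chapman-Kolmogorov, starting from the state at time \<open>s\<close> shifts the time
  axis by \<open>s\<close>.\<close>

lemma integral_cocc_tp:
  assumes "0 \<le> x" "0 \<le> s"
  shows "(\<integral>k. cocc k j x \<partial>tp s i) = cocc i j (s + x) - cocc i j s"
proof (rule integral_cocc)
  show "0 \<le> cocc i j (s + x) - cocc i j s" using cocc_mono[of s "s + x" i j] assms by simp
  have "(\<integral>\<^sup>+k. ennreal (cocc k j x) \<partial>tp s i) = (\<integral>\<^sup>+t. ennreal (pmf (tp (t + s) i) j) * indicator {0..x} t \<partial>lborel)"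
    unfolding mean_cocc
  proof (intro nn_integral_cong)
    fix t
    show "(\<integral>\<^sup>+k. ennreal (pmf (tp t k) j) \<partial>tp s i) * indicator {0..x} t = ennreal (pmf (tp (t + s) i) j) * indicator {0..x} t"
      using tp_add[of s t i] assms by (auto simp: add.commute ennreal_pmf_bind split: split_indicator)
  qed
  also have "\<dots> = ennreal (integral {0..x} (\<lambda>t. pmf (tp (t + s) i) j))"
    by (rule nn_integral_cumulative) (auto intro!: continuous_on_compose2[OF continuous_tp] continuous_intros)
  also have "integral {0..x} (\<lambda>t. pmf (tp (t + s) i) j) = integral {0 + s..x + s} (\<lambda>t. pmf (tp t i) j)"
    using integral_shift[of 0 s x "\<lambda>t. pmf (tp t i) j"] continuous_on_subset[OF continuous_tp] by (simp add: o_def)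
  also have "\<dots> = cocc i j (s + x) - cocc i j s"
    using assms by (simp add: cocc_diff add.commute)
  finally show "(\<integral>\<^sup>+k. ennreal (cocc k j x) \<partial>tp s i) = ennreal (cocc i j (s + x) - cocc i j s)" .
qed

lemma integral_cocc_stationary:
  assumes "\<And>t. 0 \<le> t \<Longrightarrow> bind_pmf q (tp t) = q" "0 \<le> x"
  shows "(\<integral>k. cocc k j x \<partial>q) = x * pmf q j"
proof (rule integral_cocc)
  have "(\<integral>\<^sup>+k. ennreal (cocc k j x) \<partial>q) = (\<integral>\<^sup>+t. ennreal (pmf q j) * indicator {0..x} t \<partial>lborel)"
    unfolding mean_cocc
  proof (intro nn_integral_cong)
    fix t
    show "(\<integral>\<^sup>+k. ennreal (pmf (tp t k) j) \<partial>q) * indicator {0..x} t = ennreal (pmf q j) * indicator {0..x} t"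
      using assms(1)[of t] ennreal_pmf_bind[of q "tp t" j] by (auto split: split_indicator)
  qed
  also have "\<dots> = ennreal (x * pmf q j)"
    using assms by (simp add: nn_integral_cmult_indicator ennreal_mult mult.commute)
  finally show "(\<integral>\<^sup>+k. ennreal (cocc k j x) \<partial>q) = ennreal (x * pmf q j)" .
qed (use assms in auto)

text \<open>At each instant the probabilities sum to 1, and the interval has length 1.\<close>

lemma cocc_mass: "(\<integral>\<^sup>+j. ennreal (cocc i j 1) \<partial>count_space UNIV) = 1"
proof -
  have "(\<integral>\<^sup>+j. ennreal (cocc i j 1) \<partial>count_space UNIV)
      = (\<integral>\<^sup>+j. \<integral>\<^sup>+t. ennreal (pmf (tp t i) j) * indicator {0..1} t \<partial>lborel \<partial>count_space UNIV)"
    by (simp add: nn_cocc)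
  also have "\<dots> = (\<integral>\<^sup>+t. \<integral>\<^sup>+j. ennreal (pmf (tp t i) j) * indicator {0..1} t \<partial>count_space UNIV \<partial>lborel)"
    by (rule nn_integral_count_space_nn_integral[symmetric]) auto
  also have "\<dots> = (\<integral>\<^sup>+t. indicator {0..1::real} t \<partial>lborel)"
    by (intro nn_integral_cong) (simp add: nn_integral_multc nn_integral_pmf measure_pmf.emeasure_space_1[simplified])
  also have "\<dots> = 1" by (subst nn_integral_indicator) auto
  finally show ?thesis .
qed

definition crest :: "'s \<Rightarrow> real \<Rightarrow> 'w \<Rightarrow> real" where
  "crest j x \<omega> = (if rat_hitting_time X j \<omega> < \<infinity> then cocc j j (x - enn2real (rat_hitting_time X j \<omega>)) else 0)"

text \<open>For a fixed hitting time the integrand is a shifted transition probability. The interval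
  is open at 0 because the first passage identity is available for \<open>0 < T\<close> only; a
  single point has measure 0.\<close>

lemma nn_integral_passage: "(\<integral>\<^sup>+T. passage j T \<omega> * indicator {0<..x} T \<partial>lborel) = ennreal (crest j x \<omega>)"
proof (cases "rat_hitting_time X j \<omega> < \<infinity>")
  case False
  then have "rat_hitting_time X j \<omega> = \<infinity>" by (simp add: not_less top_unique)
  then have "passage j T \<omega> = 0" for T by (simp add: passage_def top_unique)
  with False show ?thesis by (simp add: crest_def)
next
  case True
  then obtain \<tau> where \<tau>: "0 \<le> \<tau>" "rat_hitting_time X j \<omega> = ennreal \<tau>" by (auto simp: less_top_ennreal)
  have "AE T in lborel. T \<noteq> (0::real)" by (rule AE_lborel_singleton)
  then have "AE T in lborel. passage j T \<omega> * indicator {0<..x} T = ennreal (pmf (tp (T - \<tau>) j) j) * indicator {\<tau>..x} T"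
    by eventually_elim (use \<tau> in \<open>auto simp: passage_def ennreal_le_iff2 split: split_indicator\<close>)
  then have "(\<integral>\<^sup>+T. passage j T \<omega> * indicator {0<..x} T \<partial>lborel)
      = (\<integral>\<^sup>+T. ennreal (pmf (tp (T - \<tau>) j) j) * indicator {\<tau>..x} T \<partial>lborel)"
    by (rule nn_integral_cong_AE)
  also have "\<dots> = (\<integral>\<^sup>+T. ennreal (pmf (tp T j) j) * indicator {0..x - \<tau>} T \<partial>lborel)"
    by (rule nn_integral_shift_window) measurable
  finally show ?thesis using \<tau> by (simp add: nn_cocc crest_def)
qed

text \<open>Fubini exchanges path and time, after which the first passage identity applies at each
  time.\<close>

lemma nn_integral_crest: "(\<integral>\<^sup>+\<omega>. ennreal (crest j x \<omega>) \<partial>M i) = ennreal (cocc i j x)"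
proof -
  interpret prob_space "M i" by (rule prob_space_M)
  interpret pair_sigma_finite lborel "M i" ..
  have m: "(\<lambda>(T, \<omega>). passage j T \<omega> * indicator {0<..x} T) \<in> borel_measurable (lborel \<Otimes>\<^sub>M M i)"
    using measurable_passage[of j i] by (simp add: case_prod_unfold)
  have pm: "passage j T \<in> borel_measurable (M i)" for T
    unfolding passage_def[abs_def] by measurable
  have "(\<integral>\<^sup>+\<omega>. ennreal (crest j x \<omega>) \<partial>M i) = (\<integral>\<^sup>+\<omega>. \<integral>\<^sup>+T. passage j T \<omega> * indicator {0<..x} T \<partial>lborel \<partial>M i)"
    by (simp add: nn_integral_passage)
  also have "\<dots> = (\<integral>\<^sup>+T. \<integral>\<^sup>+\<omega>. passage j T \<omega> * indicator {0<..x} T \<partial>M i \<partial>lborel)"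
    by (rule Fubini'[OF m])
  also have "\<dots> = (\<integral>\<^sup>+T. ennreal (pmf (tp T i) j) * indicator {0..x} T \<partial>lborel)"
  proof (rule nn_integral_cong_AE)
    have "AE T in lborel. T \<noteq> (0::real)" by (rule AE_lborel_singleton)
    then show "AE T in lborel. (\<integral>\<^sup>+\<omega>. passage j T \<omega> * indicator {0<..x} T \<partial>M i) = ennreal (pmf (tp T i) j) * indicator {0..x} T"
      by eventually_elim (auto simp: nn_integral_multc pm first_passage split: split_indicator)
  qed
  finally show ?thesis by (simp add: nn_cocc)
qed

lemma measurable_crest [measurable]: "crest j x \<in> borel_measurable (M i)"
proof -
  have [measurable]: "cocc j j \<in> borel_measurable borel"
    by (intro borel_measurable_mono monoI cocc_mono)
  show ?thesis unfolding crest_def[abs_def] by measurable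
qed

end

section \<open>Convergence along real times and the occupation structure\<close>

context ct_chain
begin

lemma tp_tendsto_stationary:
  assumes st: "\<And>t. 0 \<le> t \<Longrightarrow> bind_pmf q (tp t) = q" and irr: "\<And>i j. \<exists>t\<ge>0. 0 < pmf (tp t i) j"
  shows "0 < pmf q j" "(\<lambda>n. pmf (kpow (tp 1) n i) j) \<longlonglongrightarrow> pmf q j"
    and "((\<lambda>t. pmf (tp t i) j) \<longlongrightarrow> pmf q j) at_top"
proof -
  \<comment> \<open>Waiting in \<open>j\<close> after an arrival between grid times, and being at
    \<open>i\<close> again, both have positive probability, so one \<open>n\<close> serves for both;
    this is the \<open>meet\<close> condition with \<open>i\<close> as starting state.\<close>
  have reach: "\<exists>n. 0 < pmf (kpow (tp h) n i) j \<and> 0 < pmf (kpow (tp h) n i) i" if h: "0 < h" for h i j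
  proof -
    obtain t where t: "0 \<le> t" "0 < pmf (tp t i) j" using irr by blast
    obtain n where "t / h \<le> real n" using real_arch_simple by blast
    then have n: "t \<le> real n * h" using h by (simp add: field_simps)
    have "0 < pmf (tp t i) j * pmf (tp (real n * h - t) j) j"
      using t n by (intro mult_pos_pos tp_diag_pos) auto
    also have "\<dots> \<le> pmf (tp (real n * h) i) j"
      using tp_mult_le[of t "real n * h - t" i j j] t n by simp
    finally show ?thesis
      using h tp_diag_pos[of "real n * h" i] by (auto simp: kpow_tp less_imp_le)
  qed
  show pos: "0 < pmf q j" for j
    using reach[of 1] by (intro irreducible_stationary_pos[of q "tp 1"] st) auto
  have lim: "(\<lambda>n. pmf (kpow (tp h) n i) j) \<longlonglongrightarrow> pmf q j" if h: "0 < h" for h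
    using reach[OF h] h by (intro pmf_kpow_tendsto_stationary st pos) (auto, blast)
  then show "(\<lambda>n. pmf (kpow (tp 1) n i) j) \<longlonglongrightarrow> pmf q j" by simp
  show "((\<lambda>t. pmf (tp t i) j) \<longlongrightarrow> pmf q j) at_top"
  proof (rule tendstoI)
    fix e :: real assume e: "0 < e"
    obtain \<delta> where \<delta>: "0 < \<delta>" "\<And>t t'. \<bar>t - t'\<bar> < \<delta> \<Longrightarrow> \<bar>pmf (tp t i) j - pmf (tp t' i) j\<bar> < e / 2"
      using tp_uniformly_continuous[of "e / 2" i j] e by auto
    \<comment> \<open>One skeleton suffices: uniform continuity bounds the change from a time to the
      grid point before it by \<open>e / 2\<close>.\<close>
    define h where "h = \<delta> / 2"
    have h: "0 < h" "h < \<delta>" using \<delta> by (auto simp: h_def)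
    obtain n0 where n0: "\<And>n. n \<ge> n0 \<Longrightarrow> \<bar>pmf (kpow (tp h) n i) j - pmf q j\<bar> < e / 2"
      using LIMSEQ_D[OF lim[OF h(1)], of "e / 2"] e by auto
    have "dist (pmf (tp t i) j) (pmf q j) < e" if t: "t \<ge> real n0 * h" for t
    proof -
      define n where "n = nat \<lfloor>t / h\<rfloor>"
      have t0: "0 \<le> t" using t h by (meson less_imp_le mult_nonneg_nonneg of_nat_0_le_iff order_trans)
      have "real n0 \<le> t / h" using t h by (simp add: field_simps)
      then have "n0 \<le> n" by (simp add: n_def le_nat_floor)
      have "real n \<le> t / h" "t / h < real n + 1" using t0 h unfolding n_def by (simp_all add: of_nat_nat)
      then have "real n * h \<le> t" "t < real n * h + h" using h by (simp_all add: field_simps)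
      then have "\<bar>t - real n * h\<bar> < \<delta>" using h by linarith
      from \<delta>(2)[OF this] have "\<bar>pmf (tp t i) j - pmf (kpow (tp h) n i) j\<bar> < e / 2"
        using h by (simp add: kpow_tp)
      with n0[OF \<open>n0 \<le> n\<close>] show ?thesis unfolding dist_real_def by linarith
    qed
    then show "\<forall>\<^sub>F t in at_top. dist (pmf (tp t i) j) (pmf q j) < e"
      unfolding eventually_at_top_linorder by blast
  qed
qed

lemma occupation_cocc:
  assumes st: "\<And>t. 0 \<le> t \<Longrightarrow> bind_pmf q (tp t) = q" and irr: "\<And>i j. \<exists>t\<ge>0. 0 < pmf (tp t i) j"
  shows "occupation (tp 1) q (\<lambda>i j N. cocc i j (real N)) (ct_mean_hitting M X)"
proof
  note pos = tp_tendsto_stationary(1)[OF st irr]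
  note lim = tp_tendsto_stationary(3)[OF st irr]
  fix i j N
  show "0 < pmf q j" by (rule pos)
  show "(\<lambda>n. pmf (kpow (tp 1) n i) j) \<longlonglongrightarrow> pmf q j" by (rule tp_tendsto_stationary(2)[OF st irr])
  show "0 \<le> cocc i j (real N)" by (rule cocc_nonneg)
  show "cocc i j (real N) \<le> real N" by (rule cocc_le) simp
  show "cocc i j (real N) \<le> cocc i j (real (Suc N))" by (rule cocc_mono) simp
  show "(\<integral>k. cocc k j (real N) \<partial>tp 1 i) = cocc i j (real (Suc N)) - cocc i j (real 1)"
    by (simp add: integral_cocc_tp)
  show window: "(\<lambda>N. cocc i j (real (Suc N)) - cocc i j (real N)) \<longlonglongrightarrow> pmf q j" for i j
    using LIMSEQ_Suc[OF cumulative_integral_window[OF continuous_tp lim, of 1 i j]] by (simp add: cocc_def)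
  show "(\<integral>\<^sup>+j. ennreal (cocc i j (real 1)) \<partial>count_space UNIV) = 1"
    using cocc_mass by simp
  show "(\<integral>i. cocc i j (real N) \<partial>q) = real N * pmf q j"
    by (rule integral_cocc_stationary[OF st]) auto
  have le: "ennreal (cocc j j (real N) - crest j (real N) \<omega>) \<le> rat_hitting_time X j \<omega>" for N \<omega>
  proof (cases "rat_hitting_time X j \<omega> < \<infinity>")
    case True
    then obtain \<tau> where \<tau>: "0 \<le> \<tau>" "rat_hitting_time X j \<omega> = ennreal \<tau>" by (auto simp: less_top_ennreal)
    then show ?thesis using cocc_window_le[of \<tau> "real N" j j] by (simp add: crest_def ennreal_leI)
  qed (simp add: not_less top_unique)
  have hl: "(\<lambda>N. ennreal (cocc j j (real N) - crest j (real N) \<omega>)) \<longlonglongrightarrow> ennreal (pmf q j) * rat_hitting_time X j \<omega>" for \<omega>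
  proof (cases "rat_hitting_time X j \<omega> < \<infinity>")
    case True
    then obtain \<tau> where \<tau>: "0 \<le> \<tau>" "rat_hitting_time X j \<omega> = ennreal \<tau>" by (auto simp: less_top_ennreal)
    have "(\<lambda>N. ennreal (cocc j j (real N) - cocc j j (real N - \<tau>))) \<longlonglongrightarrow> ennreal (\<tau> * pmf q j)"
      unfolding cocc_def by (intro tendsto_ennrealI cumulative_integral_window continuous_tp lim \<tau>)
    with \<tau> show ?thesis by (simp add: crest_def ennreal_mult mult.commute)
  next
    case False
    then have top: "rat_hitting_time X j \<omega> = \<infinity>" by (simp add: not_less top_unique)
    have "(\<lambda>N. ennreal (cocc j j (real N))) \<longlonglongrightarrow> \<infinity>"
      by (rule increments_imp_tendsto_top[OF window pos])
    with top show ?thesis using pos[of j] by (simp add: crest_def ennreal_mult_top)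
  qed
  have rest: "0 \<le> crest j (real N) \<omega>" "crest j (real N) \<omega> \<le> cocc j j (real N)" for N \<omega>
    by (auto simp: crest_def cocc_nonneg intro: cocc_mono)
  note * = hitting_limit[OF prob_space_M measurable_crest measurable_rat_hitting_time rest nn_integral_crest cocc_nonneg _ _ pos[of j]]
  show "cocc i j (real N) \<le> cocc j j (real N)" by (rule *(1)) (use le hl in auto)
  show "ennreal (cocc j j (real N) - cocc i j (real N)) \<le> ct_mean_hitting M X i j"
    unfolding ct_mean_hitting_eq by (rule *(2)) (use le hl in auto)
  show "(\<lambda>N. ennreal (cocc j j (real N) - cocc i j (real N))) \<longlonglongrightarrow> ennreal (pmf q j) * ct_mean_hitting M X i j"
    unfolding ct_mean_hitting_eq by (rule *(3)) (use le hl in auto)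
qed

end

theorem ct_kemeny:
  fixes \<pi> :: "'s::countable \<Rightarrow> real" and M :: "'s \<Rightarrow> 'w measure"
  assumes chain: "ct_markov_chain Q M X" and irr: "ct_irreducible M X" and st: "ct_stationary M X \<pi>"
  defines "K \<equiv> kemeny_sum \<pi> (ct_mean_hitting M X)" and "D \<equiv> ct_deviation M X \<pi>"
  shows "K i = K i'"
    and "finite (UNIV :: 's set) \<Longrightarrow> ct_deviation_exists M X \<pi> \<and> enn2ereal (K i) = ereal (\<Sum>j\<in>UNIV. D j j)"
    and "ct_deviation_exists M X \<pi> \<Longrightarrow> (\<lambda>j. D j j) summable_on UNIV \<Longrightarrow> enn2ereal (K i) = ereal (\<Sum>\<^sub>\<infinity>j. D j j)"
    and "ct_deviation_exists M X \<pi> \<Longrightarrow> \<not> (\<lambda>j. D j j) summable_on UNIV \<Longrightarrow> K i = \<infinity>"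
    and "\<not> ct_deviation_exists M X \<pi> \<Longrightarrow> K i = \<infinity>"
proof -
  interpret ct_chain Q M X using chain by unfold_locales
  obtain q where q: "pmf q = \<pi>" using st prob_dist_pmfD[of \<pi>] unfolding ct_stationary_def by blast
  have tr: "ct_transition M X t i j = pmf (tp t i) j" if "0 \<le> t" for t i j
    using that by (simp add: pmf_tp_eq)
  have stq: "bind_pmf q (tp t) = q" if t: "0 \<le> t" for t
  proof (rule pmf_eqI)
    fix j
    have "((\<lambda>i. pmf q i * pmf (tp t i) j) has_sum pmf (bind_pmf q (tp t)) j) UNIV"
      unfolding pmf_bind by (intro has_sum_pmf_integral integrable_pmf_bounded[where B=1]) (simp add: pmf_le_1)
    moreover have "((\<lambda>i. pmf q i * pmf (tp t i) j) has_sum pmf q j) UNIV"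
      using st t by (simp add: ct_stationary_def q tr)
    ultimately show "pmf (bind_pmf q (tp t)) j = pmf q j" by (rule has_sum_unique)
  qed
  have irr': "\<exists>t\<ge>0. 0 < pmf (tp t i) j" for i j
    using irr tr unfolding ct_irreducible_def by metis
  interpret occ: occupation "tp 1" q "\<lambda>i j N. cocc i j (real N)" "ct_mean_hitting M X"
    using stq irr' by (rule occupation_cocc)
  have K: "K = occ.K"
    by (simp add: fun_eq_iff K_def kemeny_sum_def occ.K_def infsum_pmf_eq_nn_integral flip: q)
  have cont: "continuous_on UNIV (\<lambda>t. pmf (tp t i) j - pmf q j)" for i j
    by (intro continuous_intros continuous_tp)
  have lim0: "((\<lambda>t. pmf (tp t i) j - pmf q j) \<longlongrightarrow> 0) at_top" for i j
    using tp_tendsto_stationary(3)[OF stq irr'] by (simp add: LIM_zero_iff)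
  have part: "integral {0..real N} (\<lambda>t. pmf (tp t i) j - pmf q j) = cocc i j (real N) - real N * pmf q j" for i j N
    unfolding cocc_def by (subst Henstock_Kurzweil_Integration.integral_diff) (auto intro: integrable_tp)
  have int: "(\<lambda>t. ct_transition M X t i j - \<pi> j) integrable_on {0..} \<longleftrightarrow> (\<lambda>t. pmf (tp t i) j - pmf q j) integrable_on {0..}" for i j
    by (rule integrable_cong) (simp add: tr q)
  have ex: "ct_deviation_exists M X \<pi> \<longleftrightarrow> (\<forall>i j. convergent (\<lambda>N. cocc i j (real N) - real N * pmf q j))"
    by (simp add: ct_deviation_exists_def int integrable_on_halfline_iff[OF cont lim0] part)
  \<comment> \<open>For a non-integrable function the integral defaults to 0, while
    \<open>lim\<close> of a divergent sequence is unspecified, so this identity is tied to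
    existence.\<close>
  have D: "D i j = lim (\<lambda>N. cocc i j (real N) - real N * pmf q j)" if "ct_deviation_exists M X \<pi>" for i j
  proof -
    have "D i j = integral {0..} (\<lambda>t. pmf (tp t i) j - pmf q j)"
      unfolding D_def ct_deviation_def by (rule integral_cong) (simp add: tr q)
    also have "\<dots> = lim (\<lambda>N. cocc i j (real N) - real N * pmf q j)"
      using that by (subst integral_halfline_eq_lim[OF cont lim0]) (auto simp: ct_deviation_exists_def int part)
    finally show ?thesis .
  qed
  show "K i = K i'" unfolding K by (subst (1 2) occ.K_const) simp
  show "ct_deviation_exists M X \<pi> \<and> enn2ereal (K i) = ereal (\<Sum>j\<in>UNIV. D j j)" if "finite (UNIV :: 's set)"
    using occ.kemeny_formula(1)[OF that, of i] ex D K by simp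
  show "enn2ereal (K i) = ereal (\<Sum>\<^sub>\<infinity>j. D j j)" if "ct_deviation_exists M X \<pi>" "(\<lambda>j. D j j) summable_on UNIV"
    using occ.kemeny_formula(2)[of i] that by (simp add: ex[symmetric] D K)
  show "K i = \<infinity>" if "ct_deviation_exists M X \<pi>" "\<not> (\<lambda>j. D j j) summable_on UNIV"
    using occ.kemeny_formula(3)[of i] that by (simp add: ex[symmetric] D K)
  show "K i = \<infinity>" if "\<not> ct_deviation_exists M X \<pi>"
    using occ.kemeny_formula(4)[of i] that by (simp add: ex K)
qed

theorem mainTheorem7:
  fixes \<pi> :: "'s::countable \<Rightarrow> real"
    and P :: "'s \<Rightarrow> 's \<Rightarrow> real" and M :: "'s \<Rightarrow> 'a measure" and X :: "nat \<Rightarrow> 'a \<Rightarrow> 's"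
    and Q :: "'s \<Rightarrow> 's \<Rightarrow> real" and N :: "'s \<Rightarrow> 'b measure" and Y :: "real \<Rightarrow> 'b \<Rightarrow> 's"
  shows
   "(dt_markov_chain P M X \<and> dt_irreducible P \<and> dt_aperiodic P \<and>
     dt_positive_recurrent M X \<and> dt_stationary P \<pi> \<longrightarrow>
       (let K = kemeny_sum \<pi> (dt_mean_hitting M X); D = dt_deviation P \<pi> in
         (\<forall>i i'. K i = K i') \<and>
         (\<forall>i.
           (finite (UNIV :: 's set) \<longrightarrow>
              dt_deviation_exists P \<pi> \<and> enn2ereal (K i) = ereal (\<Sum>j\<in>UNIV. D j j)) \<and>
           (infinite (UNIV :: 's set) \<and> dt_deviation_exists P \<pi> \<longrightarrow>
              ((\<lambda>j. D j j) summable_on UNIV \<longrightarrow> enn2ereal (K i) = ereal (\<Sum>\<^sub>\<infinity>j. D j j)) \<and>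
              (\<not> (\<lambda>j. D j j) summable_on UNIV \<longrightarrow> K i = \<infinity>)) \<and>
           (infinite (UNIV :: 's set) \<and> \<not> dt_deviation_exists P \<pi> \<longrightarrow> K i = \<infinity>))))
    \<and>
    (ct_markov_chain Q N Y \<and> ct_irreducible N Y \<and>
     ct_positive_recurrent Q N Y \<and> ct_stationary N Y \<pi> \<longrightarrow>
       (let K = kemeny_sum \<pi> (ct_mean_hitting N Y); D = ct_deviation N Y \<pi> in
         (\<forall>i i'. K i = K i') \<and>
         (\<forall>i.
           (finite (UNIV :: 's set) \<longrightarrow>
              ct_deviation_exists N Y \<pi> \<and> enn2ereal (K i) = ereal (\<Sum>j\<in>UNIV. D j j)) \<and>
           (infinite (UNIV :: 's set) \<and> ct_deviation_exists N Y \<pi> \<longrightarrow>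
              ((\<lambda>j. D j j) summable_on UNIV \<longrightarrow> enn2ereal (K i) = ereal (\<Sum>\<^sub>\<infinity>j. D j j)) \<and>
              (\<not> (\<lambda>j. D j j) summable_on UNIV \<longrightarrow> K i = \<infinity>)) \<and>
           (infinite (UNIV :: 's set) \<and> \<not> ct_deviation_exists N Y \<pi> \<longrightarrow> K i = \<infinity>))))"
  unfolding Let_def
proof (intro conjI impI; elim conjE)
  assume dt: "dt_markov_chain P M X" "dt_irreducible P" "dt_aperiodic P" "dt_stationary P \<pi>"
  note kemeny = dt_kemeny[OF dt]
  show "\<forall>i i'. kemeny_sum \<pi> (dt_mean_hitting M X) i = kemeny_sum \<pi> (dt_mean_hitting M X) i'"
    using kemeny(1) by blast
  show "\<forall>i. (finite (UNIV :: 's set) \<longrightarrow> dt_deviation_exists P \<pi> \<and>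
        enn2ereal (kemeny_sum \<pi> (dt_mean_hitting M X) i) = ereal (\<Sum>j\<in>UNIV. dt_deviation P \<pi> j j)) \<and>
      (infinite (UNIV :: 's set) \<and> dt_deviation_exists P \<pi> \<longrightarrow>
        ((\<lambda>j. dt_deviation P \<pi> j j) summable_on UNIV \<longrightarrow>
          enn2ereal (kemeny_sum \<pi> (dt_mean_hitting M X) i) = ereal (\<Sum>\<^sub>\<infinity>j. dt_deviation P \<pi> j j)) \<and>
        (\<not> (\<lambda>j. dt_deviation P \<pi> j j) summable_on UNIV \<longrightarrow> kemeny_sum \<pi> (dt_mean_hitting M X) i = \<infinity>)) \<and>
      (infinite (UNIV :: 's set) \<and> \<not> dt_deviation_exists P \<pi> \<longrightarrow> kemeny_sum \<pi> (dt_mean_hitting M X) i = \<infinity>)"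
    using kemeny(2-5) by blast
next
  assume ct: "ct_markov_chain Q N Y" "ct_irreducible N Y" "ct_stationary N Y \<pi>"
  note kemeny = ct_kemeny[OF ct]
  show "\<forall>i i'. kemeny_sum \<pi> (ct_mean_hitting N Y) i = kemeny_sum \<pi> (ct_mean_hitting N Y) i'"
    using kemeny(1) by blast
  show "\<forall>i. (finite (UNIV :: 's set) \<longrightarrow> ct_deviation_exists N Y \<pi> \<and>
        enn2ereal (kemeny_sum \<pi> (ct_mean_hitting N Y) i) = ereal (\<Sum>j\<in>UNIV. ct_deviation N Y \<pi> j j)) \<and>
      (infinite (UNIV :: 's set) \<and> ct_deviation_exists N Y \<pi> \<longrightarrow>
        ((\<lambda>j. ct_deviation N Y \<pi> j j) summable_on UNIV \<longrightarrow>
          enn2ereal (kemeny_sum \<pi> (ct_mean_hitting N Y) i) = ereal (\<Sum>\<^sub>\<infinity>j. ct_deviation N Y \<pi> j j)) \<and>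
        (\<not> (\<lambda>j. ct_deviation N Y \<pi> j j) summable_on UNIV \<longrightarrow> kemeny_sum \<pi> (ct_mean_hitting N Y) i = \<infinity>)) \<and>
      (infinite (UNIV :: 's set) \<and> \<not> ct_deviation_exists N Y \<pi> \<longrightarrow> kemeny_sum \<pi> (ct_mean_hitting N Y) i = \<infinity>)"
    using kemeny(2-5) by blast
qed

end
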